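(* Let $Y=\{Y(t),\ t\in\mathbb{R}\}$ be a Gaussian supOU process, i.e. a supOU process with characteristic quadruple $(a,b,\mu,\pi)$ where $b>0$ and $\mu\equiv0$, such that $\mathbb{E}Y=0$, and such that $\pi$ has a density $p$ with $p(x)\sim\alpha\,\ell(x^{-1})x^{\alpha-1}$ as $x\to0$ for some $\alpha\in(0,1)$ and some function $\ell$ slowly varying at infinity. Let $X(t)=\int_0^tY(s)\,ds$. Then for every family $\{s_t\}_{t>0}$ of positive numbers with $s_t\to\infty$, the family of random variables $$R(t)=\frac{1}{\sqrt{s_t}}\,\frac{X(t)}{t^{1-\alpha/2}\ell(t)^{1/2}},\qquad t>0,$$ satisfies the large deviation principle with speed $s_t$ and good rate function $$\Lambda^*(x)=\frac{1}{2b}\,\frac{(2-\alpha)(1-\alpha)}{\Gamma(1+\alpha)}\,x^2.$$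
   Context: A supOU process is $Y(t)=\int_{\mathbb{R}_+}\int_{\mathbb{R}}e^{-\xi t+s}\mathbf{1}_{[0,\infty)}(\xi t-s)\,\Lambda(d\xi,ds)$, where $\Lambda$ is a homogeneous infinitely divisible random measure (Lévy basis) on $\mathbb{R}_+\times\mathbb{R}$ with $\log\mathbb{E}e^{i\zeta\Lambda(A)}=(\pi\times\mathrm{Leb})(A)\,\kappa_L(\zeta)$ for Borel $A$, $\pi$ a probability measure on $\mathbb{R}_+$, and $\kappa_L(\zeta)=i\zeta a-\frac{\zeta^2}{2}b+\int_{\mathbb{R}}(e^{i\zeta x}-1-i\zeta x\mathbf{1}_{[-1,1]}(x))\mu(dx)$ with Lévy–Khintchine triplet $(a,b,\mu)$. A family $\{R(t)\}$ satisfies the large deviation principle with speed $s_t$ and good rate function $I$ if $I$ is lower semicontinuous with compact level sets and for every Borel $A\subset\mathbb{R}$: $-\inf_{x\in\operatorname{Int}(A)}I(x)\le\liminf_{t\to\infty}\frac{1}{s_t}\log P(R(t)\in A)\le\limsup_{t\to\infty}\frac{1}{s_t}\log P(R(t)\in A)\le-\inf_{x\in\operatorname{cl}(A)}I(x)$. *)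

theory Defs
  imports "HOL-Probability.Probability" "HOL-Analysis.Analysis"
begin

definition supOU_kernel :: "real \<Rightarrow> real \<Rightarrow> real \<Rightarrow> real" where
  "supOU_kernel \<xi> s t = exp (- \<xi> * t + s) * indicator {0..} (\<xi> * t - s)"

definition kappa_L :: "real \<Rightarrow> real \<Rightarrow> real measure \<Rightarrow> real \<Rightarrow> complex" where
  "kappa_L a b \<mu> \<zeta> = \<i> * complex_of_real (\<zeta> * a) - complex_of_real (\<zeta>^2 * b / 2)
     + (CLINT x|\<mu>. cis (\<zeta> * x) - 1 - \<i> * complex_of_real (\<zeta> * x * indicator {-1..1} x))"

text \<open>A supOU process with characteristic quadruple (a,b,mu,pi), characterised through its
  finite-dimensional distributions: for the Levy basis Lambda with control measure pi x Leb,
  log E exp(i sum_j zeta_j Y(t_j)) = integral over R_+ x R of kappa_L(sum_j zeta_j f_{t_j}).\<close>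
definition supOU_process ::
  "'w measure \<Rightarrow> (real \<Rightarrow> 'w \<Rightarrow> real) \<Rightarrow> real \<Rightarrow> real \<Rightarrow> real measure \<Rightarrow> real measure \<Rightarrow> bool" where
  "supOU_process M Y a b \<mu> \<pi> \<longleftrightarrow>
     prob_space M \<and> prob_space \<pi> \<and> sets \<pi> = sets borel \<and> emeasure \<pi> {..<0} = 0 \<and>
     (\<forall>t. Y t \<in> borel_measurable M) \<and>
     (\<forall>(n::nat) (tt::nat \<Rightarrow> real) (\<zeta>::nat \<Rightarrow> real).
        (CLINT \<omega>|M. cis (\<Sum>j<n. \<zeta> j * Y (tt j) \<omega>)) =
        exp (CLINT z|(\<pi> \<Otimes>\<^sub>M lborel).
               kappa_L a b \<mu> (\<Sum>j<n. \<zeta> j * supOU_kernel (fst z) (snd z) (tt j))))"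

definition slowly_varying :: "(real \<Rightarrow> real) \<Rightarrow> bool" where
  "slowly_varying L \<longleftrightarrow> L \<in> borel_measurable borel \<and> (\<forall>\<^sub>F x in at_top. L x > 0) \<and>
     (\<forall>c>0. ((\<lambda>x. L (c * x) / L x) \<longlongrightarrow> 1) at_top)"

definition good_rate_function :: "(real \<Rightarrow> ereal) \<Rightarrow> bool" where
  "good_rate_function I \<longleftrightarrow> (\<forall>x. I x \<ge> 0) \<and> (\<forall>c. closed {x. I x \<le> c}) \<and> (\<forall>c. compact {x. I x \<le> ereal c})"

definition eln :: "real \<Rightarrow> ereal" where
  "eln x = (if x \<le> 0 then -\<infinity> else ereal (ln x))"

definition LDP :: "'w measure \<Rightarrow> (real \<Rightarrow> 'w \<Rightarrow> real) \<Rightarrow> (real \<Rightarrow> real) \<Rightarrow> (real \<Rightarrow> ereal) \<Rightarrow> bool" where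
  "LDP M R s I \<longleftrightarrow> good_rate_function I \<and>
     (\<forall>A \<in> sets borel.
        - (INF x\<in>interior A. I x)
          \<le> Liminf at_top (\<lambda>t. eln (measure M {\<omega> \<in> space M. R t \<omega> \<in> A}) / ereal (s t)) \<and>
        Limsup at_top (\<lambda>t. eln (measure M {\<omega> \<in> space M. R t \<omega> \<in> A}) / ereal (s t))
          \<le> - (INF x\<in>closure A. I x))"

end

theory Submission
  imports Defs
begin

text \<open>
  The kernels satisfy \<open>\<integral> f\<^sub>t f\<^sub>u ds = exp (- \<xi> \<bar>t - u\<bar>) / 2\<close>, so \<open>Y\<close> is a centred stationary Gaussian process
  with covariance \<open>(b / 2) \<integral> exp (- \<xi> \<bar>t - u\<bar>) \<pi>(d\<xi>)\<close>. Its Riemann sums converge in \<open>L\<^sup>1\<close>, hence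
  \<open>X t\<close> is a centred Gaussian variable with variance \<open>b t\<^sup>2 \<integral> k (\<xi> t) \<pi>(d\<xi>)\<close>, where
  \<open>k y = (exp (- y) - 1 + y) / y\<^sup>2\<close>. Dominated convergence, with Potter's bound supplying the majorant,
  shows that this variance is asymptotic to \<open>b \<Gamma>(1 + \<alpha>) / ((1 - \<alpha>) (2 - \<alpha>)) t powr (2 - \<alpha>) L t\<close>.
  So \<open>R t\<close> is centred Gaussian with variance \<open>v t / s t\<close>, where \<open>v t\<close> converges to a positive limit,
  and the large deviation principle follows from elementary bounds on the Gaussian density.
\<close>

text \<open>\<open>supOU_process\<close> fixes only the finite-dimensional laws and says nothing
  about paths, so the law of the path integral is reached through finite sums of values of
  \<open>Y\<close>. The link is continuity in the mean: \<open>Y u - Y v\<close> is Gaussian with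
  variance \<open>b * (1 - corr (u - v))\<close>, which vanishes as \<open>u - v\<close> tends to 0.
  Joint measurability allows time integral and expectation to be exchanged. Slow variation is a
  statement about each ratio \<open>L (c * x) / L x\<close> separately, whereas a majorant needs
  these ratios for all \<open>c\<close> at once; this is the reason for proving uniform convergence.
  The range of \<alpha> makes the limiting integral of \<open>y powr (\<alpha> - 1) * k y\<close>
  converge: at 0 because \<open>k\<close> is bounded and \<alpha> > 0, at infinity because
  \<open>k y \<le> 1 / y\<close> and \<alpha> < 1. Its value is Gamma(\<alpha>) Beta(1 - \<alpha>,
  2), and the factor \<alpha> in the asymptotics of \<open>p\<close> turns Gamma(\<alpha>) into
  Gamma(1 + \<alpha>). With \<sigma> the limit of the normalised variance, the rate is the Gaussian
  exponent x * x / (2 \<sigma>).\<close>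

section \<open>Slowly varying functions\<close>

text \<open>The uniform convergence theorem for slowly varying functions, in additive form. If it failed
  along \<open>x\<^sub>n\<close>, \<open>x\<^sub>n + u\<^sub>n\<close>, the points at which the increment from either of the two is not yet
  small would form sets of vanishing measure, so some point would be close to both.\<close>
lemma slow_increments_uniform:
  fixes h :: "real \<Rightarrow> real"
  assumes h[measurable]: "h \<in> borel_measurable borel"
    and lim: "\<And>u. ((\<lambda>x. h (x + u) - h x) \<longlongrightarrow> 0) at_top"
    and e: "e > 0"
  shows "\<forall>\<^sub>F x in at_top. \<forall>u\<in>{0..1}. \<bar>h (x + u) - h x\<bar> < e"
proof (rule ccontr)
  assume "\<not> ?thesis"
  then have "\<forall>N. \<exists>x\<ge>N. \<exists>u\<in>{0..1}. \<bar>h (x + u) - h x\<bar> \<ge> e"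
    by (auto simp: eventually_at_top_linorder not_less)
  then have "\<forall>n::nat. \<exists>x u. x \<ge> real n \<and> u \<in> {0..1} \<and> \<bar>h (x + u) - h x\<bar> \<ge> e"
    by blast
  then obtain x u where xu: "\<And>n::nat. x n \<ge> real n" "\<And>n. u n \<in> {0..1}"
      "\<And>n. \<bar>h (x n + u n) - h (x n)\<bar> \<ge> e"
    by metis
  \<comment> \<open>Dominated convergence on the bounded window \<open>{0..2}\<close> turns
    pointwise convergence of increments into convergence in measure. The base points
    \<open>y\<close> are arbitrary because the claim is applied both to \<open>x n\<close> and to
    \<open>x n + u n\<close>.\<close>
  have small: "(\<lambda>n. measure lborel {w\<in>{0..2}. \<bar>h (y n + w) - h (y n)\<bar> \<ge> e / 2}) \<longlonglongrightarrow> 0"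
    if y: "\<And>n::nat. y n \<ge> real n" for y
  proof -
    have ylim: "filterlim y at_top sequentially"
      by (rule filterlim_at_top_mono[OF filterlim_real_sequentially]) (use y in auto)
    have "(\<lambda>n. \<integral>w. indicat_real {w\<in>{0..2}. \<bar>h (y n + w) - h (y n)\<bar> \<ge> e / 2} w \<partial>lborel)
      \<longlonglongrightarrow> integral\<^sup>L lborel (\<lambda>w::real. 0::real)"
    proof (rule integral_dominated_convergence[where w = "indicator {0..2}"])
      show "AE w in lborel. (\<lambda>n. indicator {w\<in>{0..2}. \<bar>h (y n + w) - h (y n)\<bar> \<ge> e / 2} w :: real)
          \<longlonglongrightarrow> 0"
      proof (rule AE_I2, rule tendsto_eventually)
        fix w
        have "(\<lambda>n. h (y n + w) - h (y n)) \<longlonglongrightarrow> 0"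
          using filterlim_compose[OF lim ylim] .
        then have "\<forall>\<^sub>F n in sequentially. \<bar>h (y n + w) - h (y n)\<bar> < e / 2"
          using e by (auto dest!: tendstoD[where e = "e/2"] simp: dist_real_def)
        then show "\<forall>\<^sub>F n in sequentially.
            (indicator {w\<in>{0..2}. \<bar>h (y n + w) - h (y n)\<bar> \<ge> e / 2} w :: real) = 0"
          by eventually_elim auto
      qed
      show "integrable lborel (indicator {0..2::real} :: real \<Rightarrow> real)" by simp
    qed (auto simp: indicator_def)
    then show ?thesis by simp
  qed
  define B where "B n = {w\<in>{0..2}. \<bar>h (x n + w) - h (x n)\<bar> \<ge> e / 2}" for n
  define C where "C n = {w\<in>{0..2}. \<bar>h (x n + u n + w) - h (x n + u n)\<bar> \<ge> e / 2}" for n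
  have Bm[measurable]: "B n \<in> sets borel" and Cm[measurable]: "C n \<in> sets borel" for n
    unfolding B_def C_def by measurable
  have "x n + u n \<ge> real n" for n using xu(1)[of n] xu(2)[of n] by auto
  from small[OF this] have C0: "(\<lambda>n. measure lborel (C n)) \<longlonglongrightarrow> 0"
    by (simp add: C_def)
  have B0: "(\<lambda>n. measure lborel (B n)) \<longlonglongrightarrow> 0"
    using small[OF xu(1)] by (simp add: B_def)
  have "\<forall>\<^sub>F n in sequentially. measure lborel (B n) < 1/2 \<and> measure lborel (C n) < 1/2"
    using order_tendstoD(2)[OF B0, of "1/2"] order_tendstoD(2)[OF C0, of "1/2"]
    by (auto intro: eventually_conj)
  then obtain n where n: "measure lborel (B n) < 1/2" "measure lborel (C n) < 1/2"
    by (auto simp: eventually_sequentially)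
  have fin: "emeasure lborel (B n) < \<infinity>" "emeasure lborel (C n) < \<infinity>"
    by (rule le_less_trans[OF emeasure_mono[of _ "{0..2}"]]; force simp: B_def C_def)+
  define C' where "C' = (\<lambda>w. u n + w) ` C n"
  have C'_eq: "C' = (+) (- u n) -` C n"
    unfolding C'_def by (force simp: image_iff)
  have C'm[measurable]: "C' \<in> sets borel"
    unfolding C'_eq by (rule measurable_sets_borel[OF _ Cm]) simp
  \<comment> \<open>For \<open>y\<close> in \<open>{1..2}\<close> both \<open>y\<close> and
    \<open>y - u n\<close> lie in the window \<open>{0..2}\<close>. If \<open>y\<close> avoided both
    sets, the triangle inequality through \<open>h (x n + y)\<close> would contradict the choice of
    \<open>u n\<close>. So length 1 is covered by two sets of measure below 1/2.\<close>
  have "{1..2} \<subseteq> B n \<union> C'"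
  proof
    fix y :: real assume y: "y \<in> {1..2}"
    show "y \<in> B n \<union> C'"
    proof (rule ccontr)
      assume ny: "y \<notin> B n \<union> C'"
      have "\<bar>h (x n + y) - h (x n)\<bar> < e/2"
        using ny y by (auto simp: B_def)
      moreover have "\<bar>h (x n + y) - h (x n + u n)\<bar> < e/2"
        using ny y xu(2)[of n] by (auto simp: C'_eq C_def)
      ultimately show False using xu(3)[of n] by linarith
    qed
  qed
  then have "emeasure lborel {1..2::real} \<le> emeasure lborel (B n) + emeasure lborel C'"
    by (intro order_trans[OF emeasure_mono emeasure_subadditive]) auto
  moreover have "emeasure lborel C' = emeasure lborel (C n)"
  proof -
    have "emeasure lborel (C n) = emeasure (distr lborel borel ((+) (- u n))) (C n)"
      by (simp add: lborel_distr_plus)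
    also have "\<dots> = emeasure lborel C'"
      by (subst emeasure_distr) (auto simp: C'_eq)
    finally show ?thesis by simp
  qed
  moreover have "emeasure lborel (B n) = ennreal (measure lborel (B n))"
      "emeasure lborel (C n) = ennreal (measure lborel (C n))"
    using fin by (auto intro!: emeasure_eq_ennreal_measure)
  ultimately have "ennreal 1 \<le> ennreal (measure lborel (B n) + measure lborel (C n))"
    by (simp add: ennreal_plus)
  then have "1 \<le> measure lborel (B n) + measure lborel (C n)"
    by (subst (asm) ennreal_le_iff) auto
  with n show False by simp
qed

text \<open>The distance is covered in steps of length at most 1, each costing at most
  \<open>e\<close>; the \<open>+ 1\<close> pays for rounding the number of steps up.\<close>

lemma slow_increments_linear_bound:
  fixes h :: "real \<Rightarrow> real"
  assumes h: "h \<in> borel_measurable borel"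
    and lim: "\<And>u. ((\<lambda>x. h (x + u) - h x) \<longlongrightarrow> 0) at_top"
    and e: "e > 0"
  obtains T where "\<And>x y. x \<ge> T \<Longrightarrow> y \<ge> T \<Longrightarrow> \<bar>h y - h x\<bar> \<le> e * (\<bar>y - x\<bar> + 1)"
proof -
  obtain T where T: "\<And>x u. x \<ge> T \<Longrightarrow> u \<in> {0..1} \<Longrightarrow> \<bar>h (x + u) - h x\<bar> < e"
    using slow_increments_uniform[OF assms] unfolding eventually_at_top_linorder by blast
  have step: "\<bar>h (x + v) - h x\<bar> \<le> e * real n" if "x \<ge> T" "0 \<le> v" "v \<le> real n" for x v n
    using that
  proof (induction n arbitrary: v)
    case 0
    then show ?case by simp
  next
    case (Suc n)
    show ?case
    proof (cases "v \<le> 1")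
      case True
      then have "\<bar>h (x + v) - h x\<bar> < e" using Suc.prems by (intro T) auto
      also have "e \<le> e * real (Suc n)" using e by simp
      finally show ?thesis by simp
    next
      case False
      then have "\<bar>h (x + (v - 1)) - h x\<bar> \<le> e * real n"
        using Suc.prems by (intro Suc.IH) auto
      moreover have "\<bar>h (x + (v - 1) + 1) - h (x + (v - 1))\<bar> < e"
        using Suc.prems False by (intro T) auto
      ultimately show ?thesis by (simp add: algebra_simps)
    qed
  qed
  have up: "\<bar>h y - h x\<bar> \<le> e * (\<bar>y - x\<bar> + 1)" if "T \<le> x" "x \<le> y" for x y
  proof -
    have "\<bar>h (x + (y - x)) - h x\<bar> \<le> e * real (nat \<lceil>y - x\<rceil>)"
      using that by (intro step) (auto intro: real_nat_ceiling_ge)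
    also have "\<dots> \<le> e * (\<bar>y - x\<bar> + 1)"
      using e that by (intro mult_left_mono) linarith+
    finally show ?thesis by simp
  qed
  show thesis
  proof (rule that)
    fix x y assume "x \<ge> T" "y \<ge> T"
    then show "\<bar>h y - h x\<bar> \<le> e * (\<bar>y - x\<bar> + 1)"
      using up[of x y] up[of y x] by (cases "x \<le> y") (auto simp: abs_minus_commute)
  qed
qed

text \<open>In logarithmic coordinates, \<open>h = ln \<circ> L \<circ> exp\<close>, slow variation
  says that increments of \<open>h\<close> vanish at infinity. The linear bound on increments
  becomes a power bound on ratios, and its additive constant becomes the factor
  \<open>exp e\<close>.\<close>

lemma potter_bound:
  assumes L: "slowly_varying L" and e: "e > 0"
  obtains T where "T > 0" "\<And>x. x \<ge> T \<Longrightarrow> L x > 0"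
    "\<And>x y. x \<ge> T \<Longrightarrow> y \<ge> T \<Longrightarrow> L y / L x \<le> exp e * exp (e * \<bar>ln (y / x)\<bar>)"
proof -
  define h where "h x = ln (L (exp x))" for x
  have Lm[measurable]: "L \<in> borel_measurable borel"
    and Lpos: "\<forall>\<^sub>F x in at_top. L x > 0"
    and Llim: "\<And>c. c > 0 \<Longrightarrow> ((\<lambda>x. L (c * x) / L x) \<longlongrightarrow> 1) at_top"
    using L by (auto simp: slowly_varying_def)
  obtain T0 where T0: "\<And>x. x \<ge> T0 \<Longrightarrow> L x > 0"
    using Lpos by (auto simp: eventually_at_top_linorder)
  have hm: "h \<in> borel_measurable borel" unfolding h_def by measurable
  have hlim: "((\<lambda>x. h (x + u) - h x) \<longlongrightarrow> 0) at_top" for u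
  proof -
    have ex: "filterlim exp at_top (at_top::real filter)" by (rule exp_at_top)
    have "((\<lambda>x. ln (L (exp u * exp x) / L (exp x))) \<longlongrightarrow> ln 1) at_top"
      using filterlim_compose[OF Llim[of "exp u"] ex] by (intro tendsto_ln) auto
    moreover have "\<forall>\<^sub>F x in at_top. ln (L (exp u * exp x) / L (exp x)) = h (x + u) - h x"
    proof -
      have 1: "\<forall>\<^sub>F x in at_top. L (exp x) > 0"
        by (rule eventually_compose_filterlim[OF Lpos ex])
      have 2: "\<forall>\<^sub>F x in at_top. L (exp (x + u)) > 0"
        by (rule eventually_compose_filterlim[OF 1, of "\<lambda>x. x + u"])
           (subst add.commute, auto intro: filterlim_tendsto_add_at_top filterlim_ident)
      show ?thesis using 1 2
        by eventually_elim (simp add: h_def ln_div exp_add mult.commute)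
    qed
    ultimately show ?thesis by (simp add: tendsto_cong)
  qed
  obtain T1 where T1: "\<And>x y. x \<ge> T1 \<Longrightarrow> y \<ge> T1 \<Longrightarrow> \<bar>h y - h x\<bar> \<le> e * (\<bar>y - x\<bar> + 1)"
    using slow_increments_linear_bound[OF hm hlim e] by blast
  define T where "T = max (exp T1) T0"
  show thesis
  proof (rule that[of T])
    show "T > 0" by (auto simp: T_def less_max_iff_disj)
    show "L x > 0" if "x \<ge> T" for x using T0 that by (auto simp: T_def)
    fix x y assume xy: "x \<ge> T" "y \<ge> T"
    with \<open>T > 0\<close> have pos: "x > 0" "y > 0" by auto
    have "ln x \<ge> T1" "ln y \<ge> T1" using xy pos by (auto simp: T_def ln_ge_iff)
    from T1[OF this] have "ln (L y) - ln (L x) \<le> e * (\<bar>ln y - ln x\<bar> + 1)"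
      using pos by (simp add: h_def)
    moreover have Lp: "L x > 0" "L y > 0" using T0 xy by (auto simp: T_def)
    ultimately have "ln (L y / L x) \<le> e + e * \<bar>ln (y / x)\<bar>"
      using pos by (simp add: ln_div algebra_simps)
    then have "exp (ln (L y / L x)) \<le> exp (e + e * \<bar>ln (y / x)\<bar>)" by simp
    then show "L y / L x \<le> exp e * exp (e * \<bar>ln (y / x)\<bar>)"
      using Lp by (simp add: exp_add)
  qed
qed

section \<open>An Abelian theorem\<close>

lemma integrable_powr_0_1:
  fixes r :: real
  assumes "r > -1"
  shows "integrable lborel (\<lambda>x. indicator {0<..1} x * x powr r)"
proof -
  have "((\<lambda>x. x powr r) has_integral (1 powr (r + 1) / (r + 1))) {0..1}"
    by (rule has_integral_powr_from_0) (use assms in auto)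
  from nn_integral_has_integral_lebesgue[OF _ this]
  have *: "(\<integral>\<^sup>+x. indicator {0..1} x * x powr r \<partial>lborel) < \<infinity>" by simp
  have "integrable lborel (\<lambda>x. indicator {0..1} x * x powr r)"
    using * by (intro integrableI_bounded) (auto simp: abs_mult)
  then show ?thesis
    by (rule Bochner_Integration.integrable_bound) (auto simp: indicator_def)
qed

lemma integrable_powr_1_top:
  fixes r :: real
  assumes "r < -1"
  shows "integrable lborel (\<lambda>x. indicator {1..} x * x powr r)"
proof -
  have "((\<lambda>x. x powr r) has_integral (- (1 powr (r + 1)) / (r + 1))) {1..}"
    by (rule has_integral_powr_to_inf) (use assms in auto)
  from nn_integral_has_integral_lebesgue[OF _ this]
  have *: "(\<integral>\<^sup>+x. indicator {1..} x * x powr r \<partial>lborel) < \<infinity>" by simp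
  show ?thesis
    using * by (intro integrableI_bounded) (auto simp: abs_mult)
qed

lemma exp_abs_ln_le:
  fixes y e :: real
  assumes "y > 0"
  shows "exp (e * \<bar>ln (1 / y)\<bar>) = (if y \<le> 1 then y powr - e else y powr e)"
  using assms by (auto simp: ln_div powr_def)

text \<open>After the substitution \<open>y = x t\<close> the integrand is dominated by Potter's bound
  for \<open>x \<le> 1 / T\<close>; the remaining part is of smaller order since \<open>k y \<le> 1 / y\<close>.\<close>
lemma abelian_slowly_varying:
  fixes L k p :: "real \<Rightarrow> real"
  assumes L: "slowly_varying L" and \<alpha>: "0 < \<alpha>" "\<alpha> < 1"
    and k[measurable]: "k \<in> borel_measurable borel"
    and k_nonneg: "\<And>y. y > 0 \<Longrightarrow> 0 \<le> k y" and k_le_1: "\<And>y. y > 0 \<Longrightarrow> k y \<le> 1"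
    and k_le_inv: "\<And>y. y > 0 \<Longrightarrow> k y \<le> 1 / y"
    and p: "integrable lborel p" and p_nonneg: "\<And>x. p x \<ge> 0"
    and p_eq: "\<And>x. x > 0 \<Longrightarrow> p x = L (1 / x) * x powr (\<alpha> - 1)"
  shows "((\<lambda>t. t powr \<alpha> / L t * (\<integral>x. indicator {0<..} x * (p x * k (x * t)) \<partial>lborel)) \<longlongrightarrow>
           (\<integral>y. indicator {0<..} y * (y powr (\<alpha> - 1) * k y) \<partial>lborel)) at_top"
proof -
  \<comment> \<open>Small enough for the three exponents used below:
    \<open>\<alpha> - 1 - e > -1\<close> and \<open>\<alpha> - 2 + e < -1\<close> make
    \<open>W\<close> integrable, and \<open>\<alpha> + e - 1 < 0\<close> kills the
    remainder.\<close>
  define e where "e = min \<alpha> (1 - \<alpha>) / 2"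
  have e: "e > 0" "e < \<alpha>" "e < 1 - \<alpha>" using \<alpha> by (auto simp: e_def min_def)
  obtain T where T: "T > 0" "\<And>x. x \<ge> T \<Longrightarrow> L x > 0"
    "\<And>x y. x \<ge> T \<Longrightarrow> y \<ge> T \<Longrightarrow> L y / L x \<le> exp e * exp (e * \<bar>ln (y / x)\<bar>)"
    using potter_bound[OF L e(1)] by metis
  have [measurable]: "L \<in> borel_measurable borel" "p \<in> borel_measurable borel"
    using L p by (auto simp: slowly_varying_def)
  have Llim: "\<And>c. c > 0 \<Longrightarrow> ((\<lambda>x. L (c * x) / L x) \<longlongrightarrow> 1) at_top"
    using L by (auto simp: slowly_varying_def)
  \<comment> \<open>The integrand after the substitution, divided by
    \<open>L t / t powr \<alpha>\<close>. The cutoff \<open>y \<le> t / T\<close> says that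
    \<open>t / y \<ge> T\<close>, which is where Potter's bound applies.\<close>
  define F where "F t y = indicator {0<..t / T} y * (L (t / y) / L t * (y powr (\<alpha> - 1) * k y))" for t y
  \<comment> \<open>Potter's factor is \<open>y powr - e\<close> up to 1 and \<open>y powr e\<close>
    beyond. It is combined with \<open>k \<le> 1\<close> on the first range and with
    \<open>k y \<le> 1 / y\<close> on the second.\<close>
  define W where "W y = exp e * (indicator {0<..1} y * y powr (\<alpha> - 1 - e)
      + indicator {1..} y * y powr (\<alpha> - 2 + e))" for y :: real
  have F_bound: "norm (F t y) \<le> W y" if t: "t \<ge> T" for t y
  proof (cases "0 < y \<and> y \<le> t / T")
    case False
    then show ?thesis by (auto simp: F_def W_def indicator_def)
  next
    case True
    then have y: "y > 0" "t / y \<ge> T" using T(1) by (auto simp: field_simps)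
    have "norm (F t y) = L (t / y) / L t * (y powr (\<alpha> - 1) * k y)"
      using True y t T(2)[of t] T(2)[of "t/y"] k_nonneg[of y] by (simp add: F_def abs_mult)
    also have "\<dots> \<le> (exp e * exp (e * \<bar>ln (t / y / t)\<bar>)) * (y powr (\<alpha> - 1) * k y)"
      using k_nonneg[of y] y t by (intro mult_right_mono T(3)) auto
    also have "t / y / t = 1 / y" using t T(1) by simp
    also have "exp e * exp (e * \<bar>ln (1 / y)\<bar>) * (y powr (\<alpha> - 1) * k y) \<le> W y"
    proof (cases "y \<le> 1")
      case True
      have "exp e * (y powr - e * (y powr (\<alpha> - 1) * k y)) \<le> exp e * (y powr - e * (y powr (\<alpha> - 1) * 1))"
        using k_le_1[of y] y by (intro mult_left_mono) auto
      also have "\<dots> = exp e * y powr (\<alpha> - 1 - e)"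
        by (simp flip: powr_add)
      also have "\<dots> \<le> W y" using y True by (auto simp: W_def indicator_def)
      finally show ?thesis using y True by (simp only: exp_abs_ln_le if_True mult.assoc)
    next
      case False
      have "exp e * (y powr e * (y powr (\<alpha> - 1) * k y)) \<le> exp e * (y powr e * (y powr (\<alpha> - 1) * (1/y)))"
        using k_le_inv[of y] y by (intro mult_left_mono) auto
      also have "1 / y = y powr (-1)" using y by (simp add: powr_minus_divide)
      also have "exp e * (y powr e * (y powr (\<alpha> - 1) * y powr (-1))) = exp e * y powr (\<alpha> - 2 + e)"
          by (simp only: powr_add[symmetric]) (rule arg_cong[where f = "\<lambda>r. exp e * y powr r"], simp)
      also have "\<dots> \<le> W y" using y False by (auto simp: W_def indicator_def)
      finally show ?thesis using y False by (simp only: exp_abs_ln_le if_False mult.assoc)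
    qed
    finally show ?thesis .
  qed
  have F_lim: "((\<lambda>t. integral\<^sup>L lborel (F t)) \<longlongrightarrow>
      (\<integral>y. indicator {0<..} y * (y powr (\<alpha> - 1) * k y) \<partial>lborel)) at_top"
  proof (rule integral_dominated_convergence_at_top[where w = W])
    show "F t \<in> borel_measurable lborel" for t unfolding F_def by measurable
    show "integrable lborel W"
      unfolding W_def using e
      by (intro integrable_mult_right Bochner_Integration.integrable_add integrable_powr_0_1 integrable_powr_1_top) auto
    show "\<forall>\<^sub>F t in at_top. AE x in lborel. norm (F t x) \<le> W x"
      by (rule eventually_mono[OF eventually_ge_at_top[of T]]) (use F_bound in auto)
    show "AE y in lborel. ((\<lambda>t. F t y) \<longlongrightarrow> indicator {0<..} y * (y powr (\<alpha> - 1) * k y)) at_top"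
    proof (rule AE_I2)
      fix y :: real
      show "((\<lambda>t. F t y) \<longlongrightarrow> indicator {0<..} y * (y powr (\<alpha> - 1) * k y)) at_top"
      proof (cases "y > 0")
        case False
        then show ?thesis by (simp add: F_def indicator_def)
      next
        case True
        have "((\<lambda>t. L (1 / y * t) / L t * (y powr (\<alpha> - 1) * k y)) \<longlongrightarrow> 1 * (y powr (\<alpha> - 1) * k y)) at_top"
          using True by (intro tendsto_intros Llim) auto
        moreover have "\<forall>\<^sub>F t in at_top. L (1 / y * t) / L t * (y powr (\<alpha> - 1) * k y) = F t y"
          using eventually_ge_at_top[of "y * T"]
          by eventually_elim (use True T(1) in \<open>auto simp: F_def field_simps\<close>)
        ultimately show ?thesis using True by (simp add: tendsto_cong)
      qed
    qed
  qed measurable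
  have pos: "x > 0" if "1 / T < x" for x
    using that T(1) by (meson less_trans zero_less_divide_1_iff)
  define P where "P = integral\<^sup>L lborel p"
  \<comment> \<open>Here \<open>1 / x < T\<close>, so nothing is known about
    \<open>L (1 / x)\<close>. Only the integrability of \<open>p\<close> is available, together with
    \<open>k (x * t) \<le> 1 / (x * t) \<le> T / t\<close>.\<close>
  define I2 where "I2 t = (\<integral>x. indicator {1 / T<..} x * (p x * k (x * t)) \<partial>lborel)" for t
  have int: "integrable lborel (\<lambda>x. indicator A x * (p x * k (x * t)))"
    if [measurable]: "A \<in> sets borel" and A: "A \<subseteq> {0<..}" and t: "t > 0" for A t
  proof (rule Bochner_Integration.integrable_bound[OF p])
    show "AE x in lborel. norm (indicator A x * (p x * k (x * t))) \<le> norm (p x)"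
    proof (rule AE_I2)
      fix x
      show "norm (indicator A x * (p x * k (x * t))) \<le> norm (p x)"
        using A t k_nonneg[of "x * t"] k_le_1[of "x * t"] p_nonneg[of x]
        by (auto simp: indicator_def abs_mult mult_left_le)
    qed
  qed measurable
  have split: "(\<integral>x. indicator {0<..} x * (p x * k (x * t)) \<partial>lborel) = L t / t powr \<alpha> * integral\<^sup>L lborel (F t) + I2 t"
    if t: "t \<ge> T" for t
  proof -
    have t0: "t > 0" using t T(1) by simp
    have "(\<integral>x. indicator {0<..} x * (p x * k (x * t)) \<partial>lborel) =
      (\<integral>x. indicator {0<..1/T} x * (p x * k (x * t)) + indicator {1/T<..} x * (p x * k (x * t)) \<partial>lborel)"
      using T(1) by (intro Bochner_Integration.integral_cong refl) (auto simp: indicator_def dest: pos)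
    also have "\<dots> = (\<integral>x. indicator {0<..1/T} x * (p x * k (x * t)) \<partial>lborel) + I2 t"
      unfolding I2_def using t0 T(1)
      by (intro Bochner_Integration.integral_add int) (auto intro: pos)
    also have "(\<integral>x. indicator {0<..1/T} x * (p x * k (x * t)) \<partial>lborel)
        = (\<integral>y. 1 / t * (indicator {0<..1/T} (y / t) * (p (y / t) * k y)) \<partial>lborel)"
      using t0 by (subst lborel_integral_real_affine[where c = "1/t" and t = 0]) auto
    also have "\<dots> = (\<integral>y. L t / t powr \<alpha> * F t y \<partial>lborel)"
    proof (rule Bochner_Integration.integral_cong[OF refl])
      fix y
      show "1 / t * (indicator {0<..1/T} (y / t) * (p (y / t) * k y)) = L t / t powr \<alpha> * F t y"
      proof (cases "0 < y \<and> y \<le> t / T")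
        case True
        then have "y > 0" "y / t \<le> 1 / T" using t0 T(1) by (auto simp: field_simps)
        moreover have "t powr \<alpha> = t * t powr (\<alpha> - 1)"
          using t0 by (metis powr_mult_base less_imp_le add_diff_cancel_left' diff_add_cancel add.commute)
        ultimately show ?thesis using True t0 T(2)[OF t]
          by (simp add: F_def p_eq powr_divide)
      next
        case False
        then have "\<not> (0 < y / t \<and> y / t \<le> 1 / T)" using t0 T(1) by (auto simp: field_simps)
        then show ?thesis using False by (auto simp: F_def indicator_def)
      qed
    qed
    finally show ?thesis by simp
  qed
  have I2: "0 \<le> I2 t" "I2 t \<le> T / t * P" if t: "t > 0" for t
  proof -
    show "0 \<le> I2 t"
      unfolding I2_def
    proof (rule Bochner_Integration.integral_nonneg)
      fix x
      show "0 \<le> indicator {1 / T<..} x * (p x * k (x * t))"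
        using t by (auto simp: indicator_def dest!: pos intro!: mult_nonneg_nonneg p_nonneg k_nonneg)
    qed
    have "I2 t \<le> (\<integral>x. T / t * p x \<partial>lborel)"
      unfolding I2_def
    proof (rule Bochner_Integration.integral_mono)
      show "integrable lborel (\<lambda>x. indicator {1 / T<..} x * (p x * k (x * t)))"
        using t T(1) by (intro int) (auto intro: pos)
      fix x
      show "indicator {1 / T<..} x * (p x * k (x * t)) \<le> T / t * p x"
      proof (cases "x > 1 / T")
        case True
        then have x: "x > 0" by (rule pos)
        have "k (x * t) \<le> 1 / (x * t)" using x t by (intro k_le_inv) simp
        also have "\<dots> \<le> T / t" using True x t T(1) by (simp add: field_simps)
        finally have "k (x * t) \<le> T / t" .
        from mult_right_mono[OF this p_nonneg[of x]] show ?thesis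
          using True by (simp add: mult.commute[of "p x"])
      next
        case False
        then show ?thesis using p_nonneg[of x] T(1) t by simp
      qed
    qed (use p in simp)
    then show "I2 t \<le> T / t * P" by (simp add: P_def)
  qed
  \<comment> \<open>Potter's bound for the pair \<open>T\<close>, \<open>t\<close> limits the growth
    of \<open>1 / L t\<close> to a multiple of \<open>t powr e\<close>. \<open>C\<close> collects
    its constants and those of the bound \<open>T / t * P\<close> on \<open>I2 t\<close>.\<close>
  define C where "C = exp e / (L T * T powr e) * T * P"
  have I2_lim: "((\<lambda>t. t powr \<alpha> / L t * I2 t) \<longlongrightarrow> 0) at_top"
  proof (rule tendsto_sandwich[OF _ _ tendsto_const])
    show "\<forall>\<^sub>F t in at_top. 0 \<le> t powr \<alpha> / L t * I2 t"
      using eventually_ge_at_top[of T]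
    proof eventually_elim
      case (elim t)
      then show ?case using I2(1)[of t] T(1) T(2)[of t] by simp
    qed
    show "\<forall>\<^sub>F t in at_top. t powr \<alpha> / L t * I2 t \<le> C * t powr (\<alpha> + e - 1)"
      using eventually_ge_at_top[of T]
    proof eventually_elim
      case (elim t)
      have t: "t > 0" using elim T(1) by simp
      have "L T / L t \<le> exp e * exp (e * \<bar>ln (T / t)\<bar>)" using elim by (intro T(3)) auto
      also have "\<bar>ln (T / t)\<bar> = ln t - ln T" using elim T(1) t by (simp add: ln_div)
      also have "exp (e * (ln t - ln T)) = t powr e / T powr e"
        using t T(1) by (simp add: powr_def exp_diff right_diff_distrib)
      finally have *: "1 / L t \<le> exp e / (L T * T powr e) * t powr e"
        using T(2)[of t] T(2)[of T] elim T(1) by (simp add: field_simps)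
      have "t powr \<alpha> / L t * I2 t \<le> t powr \<alpha> * (1 / L t) * (T / t * P)"
        using mult_left_mono[OF I2(2)[OF t], of "t powr \<alpha> / L t"] T(2)[OF elim] by simp
      also have "\<dots> \<le> t powr \<alpha> * (exp e / (L T * T powr e) * t powr e) * (T / t * P)"
        using * I2[OF t] by (intro mult_right_mono mult_left_mono) auto
      also have "\<dots> = C * (t powr \<alpha> * t powr e * t powr (-1))"
        using t by (simp add: C_def powr_minus_divide)
      also have "t powr \<alpha> * t powr e * t powr (-1) = t powr (\<alpha> + e - 1)"
        by (simp only: powr_add[symmetric]) simp
      finally show ?case .
    qed
    have "((\<lambda>t. t powr (\<alpha> + e - 1)) \<longlongrightarrow> 0) at_top"
      using e by (intro tendsto_neg_powr filterlim_ident) auto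
    from tendsto_mult_right_zero[OF this, of C]
    show "((\<lambda>t. C * t powr (\<alpha> + e - 1)) \<longlongrightarrow> 0) at_top" by simp
  qed
  have "((\<lambda>t. integral\<^sup>L lborel (F t) + t powr \<alpha> / L t * I2 t) \<longlongrightarrow>
      (\<integral>y. indicator {0<..} y * (y powr (\<alpha> - 1) * k y) \<partial>lborel) + 0) at_top"
    by (intro tendsto_add F_lim I2_lim)
  moreover have "\<forall>\<^sub>F t in at_top. integral\<^sup>L lborel (F t) + t powr \<alpha> / L t * I2 t =
      t powr \<alpha> / L t * (\<integral>x. indicator {0<..} x * (p x * k (x * t)) \<partial>lborel)"
    using eventually_ge_at_top[of T]
  proof eventually_elim
    case (elim t)
    then show ?case using T(1) T(2)[of t] unfolding split[OF elim] by (simp add: field_simps)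
  qed
  ultimately show ?thesis by (simp add: tendsto_cong)
qed

lemma abelian_regularly_varying:
  fixes L k p :: "real \<Rightarrow> real"
  assumes L: "slowly_varying L" and \<alpha>: "0 < \<alpha>" "\<alpha> < 1" and c: "c > 0"
    and k: "k \<in> borel_measurable borel" "\<And>y. y > 0 \<Longrightarrow> 0 \<le> k y"
      "\<And>y. y > 0 \<Longrightarrow> k y \<le> 1" "\<And>y. y > 0 \<Longrightarrow> k y \<le> 1 / y"
    and p: "integrable lborel p" and p_nonneg: "\<And>x. p x \<ge> 0"
    and p_asymp: "p \<sim>[at_right 0] (\<lambda>x. c * L (1 / x) * x powr (\<alpha> - 1))"
  shows "((\<lambda>t. t powr \<alpha> / L t * (\<integral>x. indicator {0<..} x * (p x * k (x * t)) \<partial>lborel)) \<longlongrightarrow>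
           c * (\<integral>y. indicator {0<..} y * (y powr (\<alpha> - 1) * k y) \<partial>lborel)) at_top"
proof -
  \<comment> \<open>\<open>L'\<close> is slowly varying and turns the asymptotic equivalence for \<open>p\<close> into an identity.\<close>
  define L' where "L' x = p (1 / x) * x powr (\<alpha> - 1)" for x
  have [measurable]: "p \<in> borel_measurable borel" using p by auto
  have Lpos: "\<forall>\<^sub>F x in at_top. L x > 0"
    and Llim: "\<And>c. c > 0 \<Longrightarrow> ((\<lambda>x. L (c * x) / L x) \<longlongrightarrow> 1) at_top"
    using L by (auto simp: slowly_varying_def)
  have inv: "filterlim (\<lambda>x::real. 1 / x) (at_right 0) at_top"
    using filterlim_inverse_at_right_top by (simp add: inverse_eq_divide)
  have "(\<lambda>x. p (1 / x)) \<sim>[at_top] (\<lambda>x. c * L (1 / (1 / x)) * (1 / x) powr (\<alpha> - 1))"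
    by (rule asymp_equiv_compose'[OF p_asymp inv])
  then have "((\<lambda>x. p (1 / x) / (c * L (1 / (1 / x)) * (1 / x) powr (\<alpha> - 1))) \<longlongrightarrow> 1) at_top"
  proof (rule asymp_equivD_strong)
    show "\<forall>\<^sub>F x in at_top. p (1 / x) \<noteq> 0 \<or> c * L (1 / (1 / x)) * (1 / x) powr (\<alpha> - 1) \<noteq> 0"
      using Lpos eventually_gt_at_top[of 0] by eventually_elim (use c in auto)
  qed
  moreover have "\<forall>\<^sub>F x in at_top. p (1 / x) / (c * L (1 / (1 / x)) * (1 / x) powr (\<alpha> - 1)) = L' x / L x / c"
    using eventually_gt_at_top[of 0]
    by eventually_elim (simp add: L'_def powr_divide field_simps)
  ultimately have "((\<lambda>x. L' x / L x / c) \<longlongrightarrow> 1) at_top" by (simp add: tendsto_cong)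
  from tendsto_mult[OF this tendsto_const[of c]]
  have ratio: "((\<lambda>x. L' x / L x) \<longlongrightarrow> c) at_top" using c by simp
  have L'pos: "\<forall>\<^sub>F x in at_top. L' x > 0"
    using order_tendstoD(1)[OF ratio c] Lpos by eventually_elim (simp add: zero_less_divide_iff)
  have sv: "slowly_varying L'"
    unfolding slowly_varying_def
  proof (intro conjI allI impI)
    show "L' \<in> borel_measurable borel" unfolding L'_def by measurable
    show "\<forall>\<^sub>F x in at_top. L' x > 0" by fact
    fix d :: real assume d: "d > 0"
    have dx: "filterlim (\<lambda>x. d * x) at_top at_top"
      using d by (intro filterlim_tendsto_pos_mult_at_top[OF tendsto_const]) (auto simp: filterlim_ident)
    \<comment> \<open>\<open>L'\<close> is \<open>L\<close> times a factor tending to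
      \<open>c > 0\<close>. The factors at \<open>d * x\<close> and at \<open>x\<close> cancel in
      the limit, so \<open>L'\<close> inherits slow variation from \<open>L\<close>.\<close>
    have "((\<lambda>x. (L' (d * x) / L (d * x)) * (L (d * x) / L x) / (L' x / L x)) \<longlongrightarrow> c * 1 / c) at_top"
      using c by (intro tendsto_intros filterlim_compose[OF ratio dx] Llim d ratio) auto
    moreover have "\<forall>\<^sub>F x in at_top. (L' (d * x) / L (d * x)) * (L (d * x) / L x) / (L' x / L x) = L' (d * x) / L' x"
      using Lpos eventually_compose_filterlim[OF Lpos dx] by eventually_elim simp
    ultimately have "((\<lambda>x. L' (d * x) / L' x) \<longlongrightarrow> c * 1 / c) at_top"
      by (rule Lim_transform_eventually)
    then show "((\<lambda>x. L' (d * x) / L' x) \<longlongrightarrow> 1) at_top" using c by simp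
  qed
  have p_eq: "p x = L' (1 / x) * x powr (\<alpha> - 1)" if "x > 0" for x
    using that by (simp add: L'_def powr_divide)
  \<comment> \<open>Normalising by \<open>L\<close> instead of \<open>L'\<close> costs the ratio
    \<open>L' t / L t\<close>, whose limit is the factor \<open>c\<close> of the conclusion.\<close>
  have "((\<lambda>t. (L' t / L t) * (t powr \<alpha> / L' t * (\<integral>x. indicator {0<..} x * (p x * k (x * t)) \<partial>lborel))) \<longlongrightarrow>
           c * (\<integral>y. indicator {0<..} y * (y powr (\<alpha> - 1) * k y) \<partial>lborel)) at_top"
    by (intro tendsto_mult ratio abelian_slowly_varying[OF sv \<alpha> k p p_nonneg p_eq])
  moreover have "\<forall>\<^sub>F t in at_top. (L' t / L t) * (t powr \<alpha> / L' t * (\<integral>x. indicator {0<..} x * (p x * k (x * t)) \<partial>lborel))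
      = t powr \<alpha> / L t * (\<integral>x. indicator {0<..} x * (p x * k (x * t)) \<partial>lborel)"
    using L'pos by eventually_elim simp
  ultimately show ?thesis by (simp add: tendsto_cong)
qed

section \<open>The limiting constant\<close>

text \<open>The variance of \<open>\<integral>\<^sub>0\<^sup>t Y\<close> is \<open>b t\<^sup>2 \<integral> ou_kernel (\<xi> t) \<pi>(d\<xi>)\<close>.
  At 0 the division gives the junk value 0 instead of the continuous extension 1/2.\<close>
definition ou_kernel :: "real \<Rightarrow> real" where
  "ou_kernel y = (exp (- y) - 1 + y) / y\<^sup>2"

lemma ou_kernel_measurable [measurable]: "ou_kernel \<in> borel_measurable borel"
  unfolding ou_kernel_def[abs_def] by measurable

lemma ou_kernel_nonneg: "0 \<le> ou_kernel y"
  using exp_ge_add_one_self[of "- y"] by (simp add: ou_kernel_def)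

lemma ou_kernel_le_inverse: "ou_kernel y \<le> 1 / y" if "y > 0"
  using that by (simp add: ou_kernel_def divide_simps power2_eq_square)

lemma ou_kernel_le_1: "ou_kernel y \<le> 1" if "y > 0"
proof -
  have "exp (- y) = 1 / exp y" by (simp add: exp_minus divide_inverse)
  also have "\<dots> \<le> 1 / (1 + y)" using that by (intro divide_left_mono) auto
  also have "\<dots> \<le> 1 - y + y\<^sup>2"
    using that by (simp add: field_simps power2_eq_square)
  finally show ?thesis using that by (simp add: ou_kernel_def)
qed

text \<open>The weight \<open>t - v\<close> is the length of the set of starting points in
  \<open>[0, t]\<close> whose shift by the lag \<open>v\<close> stays in \<open>[0, t]\<close>.
  Twice this integral is therefore the double integral of the exponential correlation over the
  square.\<close>

lemma has_bochner_integral_exp_weighted: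
  assumes y: "y \<noteq> 0" and t: "t \<ge> 0"
  shows "has_bochner_integral lborel (\<lambda>v. ((t - v) * exp (- y * v)) * indicator {0..t} v) (t\<^sup>2 * ou_kernel (y * t))"
proof -
  define F where "F v = - (t - v) * exp (- y * v) / y + exp (- y * v) / y\<^sup>2" for v
  have "has_bochner_integral lborel (\<lambda>v. ((t - v) * exp (- y * v)) * indicator {0..t} v) (F t - F 0)"
  proof (rule has_bochner_integral_FTC_Icc_real[OF t])
    show "DERIV F x :> (t - x) * exp (- y * x)" for x
      unfolding F_def using y
      by (auto intro!: derivative_eq_intros simp: field_simps power2_eq_square)
  qed (intro continuous_intros)
  also have "F t - F 0 = t\<^sup>2 * ou_kernel (y * t)"
    using y by (cases "t = 0") (simp_all add: F_def ou_kernel_def field_simps power2_eq_square)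
  finally show ?thesis .
qed

lemma Beta_2: "Beta a 2 = 1 / (a * (a + 1))" if "a > 0" for a :: real
proof -
  have "Gamma (a + 1) = a * Gamma a"
    using that nonpos_Ints_nonpos[of a] by (intro Gamma_plus1) auto
  moreover have "Gamma (a + 1 + 1) = (a + 1) * Gamma (a + 1)"
    using that nonpos_Ints_nonpos[of "a + 1"] by (intro Gamma_plus1) auto
  moreover have "a + 2 = a + 1 + 1" by simp
  ultimately have "Gamma (a + 2) = (a + 1) * (a * Gamma a)" by metis
  moreover have "Gamma (2::real) = 1" using Gamma_fact[of 1, where 'a = real] by simp
  moreover have "Gamma a > 0" using that by (rule Gamma_real_pos)
  ultimately show ?thesis by (simp add: Beta_def)
qed

text \<open>Rescaling by \<open>v\<close> gives Euler's integral; the Jacobian \<open>1 / v\<close>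
  and the factor \<open>v powr (1 - \<alpha>)\<close> combine to
  \<open>v powr (- \<alpha>)\<close>.\<close>

lemma nn_integral_powr_exp:
  fixes \<alpha> v :: real
  assumes \<alpha>: "\<alpha> > 0" and v: "v > 0"
  shows "(\<integral>\<^sup>+y. indicator {0<..} y * ennreal (y powr (\<alpha> - 1) * exp (- y * v)) \<partial>lborel) = ennreal (Gamma \<alpha> * v powr (- \<alpha>))"
proof -
  have "(\<integral>\<^sup>+y. indicator {0<..} y * ennreal (y powr (\<alpha> - 1) * exp (- y * v)) \<partial>lborel)
    = (1 / v) * (\<integral>\<^sup>+y. indicator {0<..} (y / v) * ennreal ((y / v) powr (\<alpha> - 1) * exp (- (y / v) * v)) \<partial>lborel)"
    using v by (subst nn_integral_real_affine[where c = "1 / v" and t = 0]) auto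
  also have "(\<integral>\<^sup>+y. indicator {0<..} (y / v) * ennreal ((y / v) powr (\<alpha> - 1) * exp (- (y / v) * v)) \<partial>lborel)
     = (\<integral>\<^sup>+y. ennreal (v powr (1 - \<alpha>)) * ennreal (indicator {0..} y * y powr (\<alpha> - 1) / exp y) \<partial>lborel)"
  proof (rule nn_integral_cong_AE, rule AE_I[where N = "{0}"])
    show "{y \<in> space lborel. indicator {0<..} (y / v) * ennreal ((y / v) powr (\<alpha> - 1) * exp (- (y / v) * v))
      \<noteq> ennreal (v powr (1 - \<alpha>)) * ennreal (indicator {0..} y * y powr (\<alpha> - 1) / exp y)} \<subseteq> {0}"
    proof safe
      fix y
      assume ne: "indicator {0<..} (y / v) * ennreal ((y / v) powr (\<alpha> - 1) * exp (- (y / v) * v))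
      \<noteq> ennreal (v powr (1 - \<alpha>)) * ennreal (indicator {0..} y * y powr (\<alpha> - 1) / exp y)"
      show "y = 0"
      proof (rule ccontr)
        assume "y \<noteq> 0"
        then consider "y > 0" | "y < 0" by linarith
        then show False
        proof cases
          case 1
          have "(y / v) powr (\<alpha> - 1) * exp (- (y / v) * v) = v powr (1 - \<alpha>) * (y powr (\<alpha> - 1) / exp y)"
            using 1 v by (simp add: powr_divide powr_diff exp_minus field_simps)
          then show False using ne 1 v by (simp add: ennreal_mult[symmetric])
        next
          case 2
          then show False using ne v by (simp add: zero_less_divide_iff)
        qed
      qed
    qed
  qed auto
  also have "\<dots> = ennreal (v powr (1 - \<alpha>)) * Gamma \<alpha>"
    by (subst nn_integral_cmult) (simp_all add: Gamma_conv_nn_integral_real[OF \<alpha>])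
  also have "ennreal (1 / v) * (ennreal (v powr (1 - \<alpha>)) * Gamma \<alpha>) = ennreal (Gamma \<alpha> * v powr (- \<alpha>))"
    using v \<alpha> Gamma_real_pos[OF \<alpha>]
    by (simp add: ennreal_mult[symmetric] powr_diff powr_minus divide_simps)
  finally show ?thesis .
qed

text \<open>\<open>ou_kernel y\<close> is the integral of \<open>(1 - v) * exp (- y * v)\<close>
  over \<open>v\<close> in \<open>[0, 1]\<close>. After Tonelli the integral over \<open>y\<close>
  is \<open>Gamma \<alpha> * v powr (- \<alpha>)\<close>, which leaves Beta(1 - \<alpha>, 2) = 1 /
  ((1 - \<alpha>) (2 - \<alpha>)).\<close>

lemma nn_integral_powr_ou_kernel:
  assumes \<alpha>: "0 < \<alpha>" "\<alpha> < 1"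
  shows "(\<integral>\<^sup>+y. indicator {0<..} y * ennreal (y powr (\<alpha> - 1) * ou_kernel y) \<partial>lborel)
    = ennreal (Gamma \<alpha> / ((1 - \<alpha>) * (2 - \<alpha>)))"
proof -
  have G: "Gamma \<alpha> > 0" using \<alpha> by (simp add: Gamma_real_pos)
  have k: "ennreal (ou_kernel y) = (\<integral>\<^sup>+v. indicator {0..1} v * ennreal ((1 - v) * exp (- y * v)) \<partial>lborel)"
    if "y > 0" for y
  proof -
    have "has_bochner_integral lborel (\<lambda>v. ((1 - v) * exp (- y * v)) * indicator {0..1} v) (ou_kernel y)"
      using has_bochner_integral_exp_weighted[of y 1] that by simp
    then have "(\<integral>\<^sup>+v. ennreal ((1 - v) * exp (- y * v) * indicator {0..1} v) \<partial>lborel) = ennreal (ou_kernel y)"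
      by (subst nn_integral_eq_integral) (auto simp: has_bochner_integral_iff indicator_def)
    moreover have "(\<integral>\<^sup>+v. indicator {0..1} v * ennreal ((1 - v) * exp (- y * v)) \<partial>lborel)
        = (\<integral>\<^sup>+v. ennreal ((1 - v) * exp (- y * v) * indicator {0..1} v) \<partial>lborel)"
      by (intro nn_integral_cong) (auto simp: indicator_def)
    ultimately show ?thesis by simp
  qed
  have "(\<integral>\<^sup>+y. indicator {0<..} y * ennreal (y powr (\<alpha> - 1) * ou_kernel y) \<partial>lborel)
    = (\<integral>\<^sup>+y. (\<integral>\<^sup>+v. indicator {0<..} y * ennreal (y powr (\<alpha> - 1)) * (indicator {0..1} v * ennreal ((1 - v) * exp (- y * v))) \<partial>lborel) \<partial>lborel)"
  proof (rule nn_integral_cong)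
    fix y :: real
    have "(\<integral>\<^sup>+v. indicator {0<..} y * ennreal (y powr (\<alpha> - 1)) * (indicator {0..1} v * ennreal ((1 - v) * exp (- y * v))) \<partial>lborel)
      = indicator {0<..} y * ennreal (y powr (\<alpha> - 1)) * (\<integral>\<^sup>+v. indicator {0..1} v * ennreal ((1 - v) * exp (- y * v)) \<partial>lborel)"
      by (subst nn_integral_cmult) auto
    then show "indicator {0<..} y * ennreal (y powr (\<alpha> - 1) * ou_kernel y) = (\<integral>\<^sup>+v. indicator {0<..} y * ennreal (y powr (\<alpha> - 1)) * (indicator {0..1} v * ennreal ((1 - v) * exp (- y * v))) \<partial>lborel)"
      using k[of y] by (cases "y > 0") (simp_all add: ennreal_mult ou_kernel_nonneg)
  qed
  also have "\<dots> = (\<integral>\<^sup>+v. (\<integral>\<^sup>+y. indicator {0<..} y * ennreal (y powr (\<alpha> - 1)) * (indicator {0..1} v * ennreal ((1 - v) * exp (- y * v))) \<partial>lborel) \<partial>lborel)"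
    by (rule lborel_pair.Fubini'[symmetric]) measurable
  also have "\<dots> = (\<integral>\<^sup>+v. ennreal (Gamma \<alpha>) * ennreal (indicator {0..1} v * (v powr ((1 - \<alpha>) - 1) * (1 - v) powr (2 - 1))) \<partial>lborel)"
  \<comment> \<open>The point \<open>v = 0\<close> has to be left out: there the inner integral
    diverges, while the right-hand side is 0 because \<open>0 powr r = 0\<close>.\<close>
  proof (rule nn_integral_cong_AE, rule AE_mp[OF AE_lborel_singleton[of 0]], rule AE_I2, rule impI)
    fix v :: real assume v0: "v \<noteq> 0"
    show "(\<integral>\<^sup>+y. indicator {0<..} y * ennreal (y powr (\<alpha> - 1)) * (indicator {0..1} v * ennreal ((1 - v) * exp (- y * v))) \<partial>lborel)
      = ennreal (Gamma \<alpha>) * ennreal (indicator {0..1} v * (v powr ((1 - \<alpha>) - 1) * (1 - v) powr (2 - 1)))"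
    proof (cases "v \<in> {0..1}")
      case True
      then have v: "v > 0" "v \<le> 1" using v0 by auto
      have "(\<integral>\<^sup>+y. indicator {0<..} y * ennreal (y powr (\<alpha> - 1)) * (indicator {0..1} v * ennreal ((1 - v) * exp (- y * v))) \<partial>lborel)
        = (\<integral>\<^sup>+y. ennreal (1 - v) * (indicator {0<..} y * ennreal (y powr (\<alpha> - 1) * exp (- y * v))) \<partial>lborel)"
        using v by (intro nn_integral_cong) (simp add: ennreal_mult mult_ac)
      also have "\<dots> = ennreal (1 - v) * ennreal (Gamma \<alpha> * v powr (- \<alpha>))"
        using v nn_integral_powr_exp[OF \<alpha>(1), of v] by (subst nn_integral_cmult) auto
      finally show ?thesis using v G by (simp add: ennreal_mult[symmetric] mult_ac powr_one)
    qed simp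
  qed
  also have "\<dots> = ennreal (Gamma \<alpha>) * (\<integral>\<^sup>+v. ennreal (indicator {0..1} v * (v powr ((1 - \<alpha>) - 1) * (1 - v) powr (2 - 1))) \<partial>lborel)"
    by (rule nn_integral_cmult) measurable
  also have "\<dots> = ennreal (Gamma \<alpha>) * ennreal (Beta (1 - \<alpha>) 2)"
    using \<alpha> by (subst nn_integral_has_integral_lebesgue[OF _ has_integral_Beta_real]) auto
  also have "\<dots> = ennreal (Gamma \<alpha> / ((1 - \<alpha>) * (2 - \<alpha>)))"
    using \<alpha> G Beta_2[of "1 - \<alpha>"] by (simp add: ennreal_mult[symmetric])
  finally show ?thesis .
qed

lemma integral_powr_ou_kernel:
  assumes \<alpha>: "0 < \<alpha>" "\<alpha> < 1"
  shows "\<alpha> * (\<integral>y. indicator {0<..} y * (y powr (\<alpha> - 1) * ou_kernel y) \<partial>lborel)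
    = Gamma (1 + \<alpha>) / ((1 - \<alpha>) * (2 - \<alpha>))"
proof -
  have "(\<integral>y. indicator {0<..} y * (y powr (\<alpha> - 1) * ou_kernel y) \<partial>lborel) = Gamma \<alpha> / ((1 - \<alpha>) * (2 - \<alpha>))"
  proof (subst integral_eq_nn_integral)
    have "(\<integral>\<^sup>+y. ennreal (indicator {0<..} y * (y powr (\<alpha> - 1) * ou_kernel y)) \<partial>lborel)
       = (\<integral>\<^sup>+y. indicator {0<..} y * ennreal (y powr (\<alpha> - 1) * ou_kernel y) \<partial>lborel)"
      by (intro nn_integral_cong) (auto simp: indicator_def)
    then show "enn2real (\<integral>\<^sup>+y. ennreal (indicator {0<..} y * (y powr (\<alpha> - 1) * ou_kernel y)) \<partial>lborel)
        = Gamma \<alpha> / ((1 - \<alpha>) * (2 - \<alpha>))"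
      using \<alpha> Gamma_real_pos[of \<alpha>] by (simp add: nn_integral_powr_ou_kernel)
  qed (auto simp: ou_kernel_nonneg)
  moreover have "Gamma (1 + \<alpha>) = \<alpha> * Gamma \<alpha>"
    using \<alpha> nonpos_Ints_nonpos[of \<alpha>] Gamma_plus1[of \<alpha>] by (auto simp: add.commute)
  ultimately show ?thesis by simp
qed

section \<open>Large deviations of Gaussian variables\<close>

text \<open>If \<open>x\<close> has absolute value at least \<open>m\<close> and \<open>m'\<close>
  is \<open>m\<close> or \<open>- m\<close> with the sign of \<open>x\<close>, then x * x is at
  least m * m + (x - m') * (x - m'). Thus the density is at most \<open>c\<close> times a density
  recentred at \<open>m'\<close>. Adding both recentred densities covers both signs and gives the
  factor 2.\<close>

lemma (in prob_space) normal_tail_le: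
  assumes X: "distributed M lborel X (normal_density 0 \<tau>)" and \<tau>: "\<tau> > 0"
    and A: "A \<in> sets borel" "\<And>x. x \<in> A \<Longrightarrow> m \<le> \<bar>x\<bar>" and m: "m \<ge> 0"
  shows "prob {\<omega> \<in> space M. X \<omega> \<in> A} \<le> 2 * exp (- m\<^sup>2 / (2 * \<tau>\<^sup>2))"
proof -
  define c where "c = exp (- m\<^sup>2 / (2 * \<tau>\<^sup>2))"
  have le: "normal_density 0 \<tau> x * indicator A x \<le> c * (normal_density m \<tau> x + normal_density (- m) \<tau> x)" for x
  proof (cases "x \<in> A")
    case True
    have *: "normal_density 0 \<tau> x \<le> c * normal_density m' \<tau> x" if "m'\<^sup>2 = m\<^sup>2" "m'\<^sup>2 \<le> m' * x" for m'
    proof -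
      have "- x\<^sup>2 \<le> - m\<^sup>2 + - (x - m')\<^sup>2"
        using that by (simp add: power2_eq_square algebra_simps)
      then have "- x\<^sup>2 / (2 * \<tau>\<^sup>2) \<le> (- m\<^sup>2 + - (x - m')\<^sup>2) / (2 * \<tau>\<^sup>2)"
        by (rule divide_right_mono) simp
      then have "exp (- x\<^sup>2 / (2 * \<tau>\<^sup>2)) \<le> c * exp (- (x - m')\<^sup>2 / (2 * \<tau>\<^sup>2))"
        unfolding c_def exp_add[symmetric] add_divide_distrib[symmetric] by simp
      then show ?thesis
        unfolding normal_density_def mult.left_commute[of c] by (intro mult_left_mono) auto
    qed
    have nn: "normal_density m \<tau> x \<ge> 0" "normal_density (- m) \<tau> x \<ge> 0" "c \<ge> 0"
      by (auto simp: c_def)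
    show ?thesis
    proof (cases "x \<ge> 0")
      case True
      then have "m * m \<le> m * x" using A(2)[OF \<open>x \<in> A\<close>] m by (intro mult_left_mono) auto
      then have "normal_density 0 \<tau> x \<le> c * normal_density m \<tau> x" by (intro *) (auto simp: power2_eq_square)
      then show ?thesis using \<open>x \<in> A\<close> nn by (simp add: distrib_left add_increasing2)
    next
      case False
      then have "m * m \<le> m * (- x)" using A(2)[OF \<open>x \<in> A\<close>] m by (intro mult_left_mono) auto
      then have "normal_density 0 \<tau> x \<le> c * normal_density (- m) \<tau> x" by (intro *) (auto simp: power2_eq_square)
      then show ?thesis using \<open>x \<in> A\<close> nn by (simp add: distrib_left add_increasing)
    qed
  qed (simp add: c_def)
  have int: "(\<integral>\<^sup>+x. ennreal (normal_density \<mu> \<tau> x) \<partial>lborel) = 1" for \<mu>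
    using \<tau> by (subst nn_integral_eq_integral) (auto simp: integral_normal_density)
  have "emeasure M (X -` A \<inter> space M) = (\<integral>\<^sup>+x. ennreal (normal_density 0 \<tau> x) * indicator A x \<partial>lborel)"
    using A(1) by (intro distributed_emeasure[OF X]) simp
  also have "\<dots> \<le> (\<integral>\<^sup>+x. ennreal c * (ennreal (normal_density m \<tau> x) + ennreal (normal_density (- m) \<tau> x)) \<partial>lborel)"
  proof (rule nn_integral_mono)
    fix x
    have "ennreal (normal_density 0 \<tau> x) * indicator A x = ennreal (normal_density 0 \<tau> x * indicator A x)"
      by (auto simp: indicator_def)
    also have "\<dots> \<le> ennreal (c * (normal_density m \<tau> x + normal_density (- m) \<tau> x))"
      by (rule ennreal_leI[OF le])
    also have "\<dots> = ennreal c * (ennreal (normal_density m \<tau> x) + ennreal (normal_density (- m) \<tau> x))"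
      by (simp add: ennreal_mult c_def)
    finally show "ennreal (normal_density 0 \<tau> x) * indicator A x
      \<le> ennreal c * (ennreal (normal_density m \<tau> x) + ennreal (normal_density (- m) \<tau> x))" .
  qed
  also have "\<dots> = ennreal c * (1 + 1)"
    by (subst nn_integral_cmult) (auto simp: nn_integral_add int)
  also have "\<dots> = ennreal (2 * c)" by (simp add: c_def ennreal_mult'' mult.commute)
  finally have "emeasure M {\<omega> \<in> space M. X \<omega> \<in> A} \<le> ennreal (2 * c)"
    by (simp add: vimage_def Int_def conj_commute)
  then show ?thesis by (simp add: emeasure_eq_measure c_def)
qed

text \<open>The interval has length \<open>2 * e\<close>, and on it the density is at least its
  value at distance \<open>\<bar>x\<bar> + e\<close> from the mean.\<close>

lemma (in prob_space) normal_interval_ge: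
  assumes X: "distributed M lborel X (normal_density 0 \<tau>)" and \<tau>: "\<tau> > 0"
    and A: "A \<in> sets borel" "{x - e<..<x + e} \<subseteq> A" and e: "e > 0"
  shows "prob {\<omega> \<in> space M. X \<omega> \<in> A} \<ge> 2 * e / sqrt (2 * pi * \<tau>\<^sup>2) * exp (- (\<bar>x\<bar> + e)\<^sup>2 / (2 * \<tau>\<^sup>2))"
proof -
  define c where "c = 1 / sqrt (2 * pi * \<tau>\<^sup>2) * exp (- (\<bar>x\<bar> + e)\<^sup>2 / (2 * \<tau>\<^sup>2))"
  have c: "c \<ge> 0" by (simp add: c_def)
  have le: "c \<le> normal_density 0 \<tau> y" if "y \<in> {x - e<..<x + e}" for y
  proof -
    have "\<bar>y\<bar> \<le> \<bar>x\<bar> + e" using that by auto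
    then have "y\<^sup>2 \<le> (\<bar>x\<bar> + e)\<^sup>2" by (metis abs_ge_zero power2_abs power_mono)
    then show ?thesis
      unfolding normal_density_def c_def by (intro mult_left_mono) (auto simp: divide_right_mono)
  qed
  have "ennreal (2 * e * c) = (\<integral>\<^sup>+y. ennreal c * indicator {x - e<..<x + e} y \<partial>lborel)"
    using e c by (subst nn_integral_cmult_indicator) (auto simp: ennreal_mult''[symmetric] mult.commute)
  also have "\<dots> \<le> (\<integral>\<^sup>+y. ennreal (normal_density 0 \<tau> y) * indicator A y \<partial>lborel)"
    using A(2) le by (intro nn_integral_mono) (auto simp: indicator_def intro!: ennreal_leI)
  also have "\<dots> = emeasure M (X -` A \<inter> space M)"
    using A(1) by (intro distributed_emeasure[OF X, symmetric]) simp
  also have "X -` A \<inter> space M = {\<omega> \<in> space M. X \<omega> \<in> A}" by auto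
  finally have "2 * e * c \<le> prob {\<omega> \<in> space M. X \<omega> \<in> A}"
    by (simp add: emeasure_eq_measure)
  then show ?thesis by (simp add: c_def)
qed

lemma good_rate_function_square:
  assumes c: "c > 0"
  shows "good_rate_function (\<lambda>x. ereal (c * x\<^sup>2))"
  unfolding good_rate_function_def
proof (intro conjI allI)
  show "0 \<le> ereal (c * x\<^sup>2)" for x using c by simp
  have real_level: "closed {x::real. c * x\<^sup>2 \<le> d}" for d
    by (intro closed_Collect_le continuous_intros)
  show cl: "closed {x::real. ereal (c * x\<^sup>2) \<le> d}" for d
  proof (cases d)
    case (real r)
    then show ?thesis using real_level[of r] by simp
  qed simp_all
  show "compact {x::real. ereal (c * x\<^sup>2) \<le> ereal d}" for d
    unfolding compact_eq_bounded_closed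
  proof
    show "bounded {x::real. ereal (c * x\<^sup>2) \<le> ereal d}"
    proof (rule boundedI)
      fix x assume "x \<in> {x::real. ereal (c * x\<^sup>2) \<le> ereal d}"
      then have "x\<^sup>2 \<le> d / c" using c by (simp add: pos_le_divide_eq mult.commute)
      then have "sqrt (x\<^sup>2) \<le> sqrt (d / c)" by (rule real_sqrt_le_mono)
      then show "norm x \<le> sqrt (d / c)" by simp
    qed
  qed (rule cl)
qed

lemma eln_mono: "x \<le> y \<Longrightarrow> eln x \<le> eln y"
  by (auto simp: eln_def)

text \<open>The rate increases with the distance from 0, so a set is governed by its points nearest
  to 0. The upper bound is the tail bound there, its factor 2 contributing only
  \<open>ln 2 / s t\<close>; the lower bound uses small intervals around interior points.\<close>

lemma LDP_normal:
  assumes M: "prob_space M"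
    and R: "\<forall>\<^sub>F t in at_top. distributed M lborel (R t) (normal_density 0 (sqrt (v t / s t)))"
    and v: "(v \<longlongrightarrow> \<sigma>) at_top" and \<sigma>: "\<sigma> > 0"
    and s: "filterlim s at_top at_top"
  shows "LDP M R s (\<lambda>x. ereal (1 / (2 * \<sigma>) * x\<^sup>2))"
proof -
  interpret prob_space M by fact
  let ?I = "\<lambda>x. ereal (1 / (2 * \<sigma>) * x\<^sup>2)"
  let ?l = "\<lambda>A t. eln (prob {\<omega> \<in> space M. R t \<omega> \<in> A}) / ereal (s t)"
  have ev: "\<forall>\<^sub>F t in at_top. s t > 0 \<and> v t > 0"
    using order_tendstoD(1)[OF v \<sigma>] s by (auto simp: filterlim_at_top_dense intro: eventually_conj)
  have inv: "((\<lambda>t. 1 / s t) \<longlongrightarrow> 0) at_top"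
    using tendsto_inverse_0_at_top[OF s] by (simp add: inverse_eq_divide)
  have up: "Limsup at_top (?l A) \<le> - ?I m"
    if A: "A \<in> sets borel" "\<And>x. x \<in> A \<Longrightarrow> \<bar>m\<bar> \<le> \<bar>x\<bar>" for A m
  proof -
    have "((\<lambda>t. ereal (ln 2 * (1 / s t) - m\<^sup>2 / (2 * v t))) \<longlongrightarrow> ereal (ln 2 * 0 - m\<^sup>2 / (2 * \<sigma>))) at_top"
      using \<sigma> by (intro tendsto_intros inv v) auto
    then have "Limsup at_top (\<lambda>t. ereal (ln 2 * (1 / s t) - m\<^sup>2 / (2 * v t))) = - ?I m"
      by (subst lim_imp_Limsup) auto
    moreover have "Limsup at_top (?l A) \<le> Limsup at_top (\<lambda>t. ereal (ln 2 * (1 / s t) - m\<^sup>2 / (2 * v t)))"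
    proof (rule Limsup_mono)
      show "\<forall>\<^sub>F t in at_top. ?l A t \<le> ereal (ln 2 * (1 / s t) - m\<^sup>2 / (2 * v t))"
        using R ev
      proof eventually_elim
        case (elim t)
        then have st: "s t > 0" "v t > 0" by auto
        have "prob {\<omega> \<in> space M. R t \<omega> \<in> A} \<le> 2 * exp (- \<bar>m\<bar>\<^sup>2 / (2 * (sqrt (v t / s t))\<^sup>2))"
          using elim A by (intro normal_tail_le[where \<tau> = "sqrt (v t / s t)"]) auto
        also have "\<dots> = 2 * exp (- (s t * m\<^sup>2) / (2 * v t))" using st by simp
        finally have "eln (prob {\<omega> \<in> space M. R t \<omega> \<in> A}) \<le> eln (2 * exp (- (s t * m\<^sup>2) / (2 * v t)))"
          by (rule eln_mono)
        also have "\<dots> = ereal (ln 2 - (s t * m\<^sup>2) / (2 * v t))"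
          by (simp add: eln_def ln_mult)
        finally have "?l A t \<le> ereal (ln 2 - (s t * m\<^sup>2) / (2 * v t)) / ereal (s t)"
          using st by (intro ereal_divide_right_mono) auto
        also have "\<dots> = ereal (ln 2 * (1 / s t) - m\<^sup>2 / (2 * v t))"
          using st by (simp add: diff_divide_distrib)
        finally show ?case .
      qed
    qed
    ultimately show ?thesis by simp
  qed
  have low_eps: "- ereal ((\<bar>x\<bar> + e)\<^sup>2 / (2 * \<sigma>)) \<le> Liminf at_top (?l A)"
    if A: "A \<in> sets borel" "{x - e<..<x + e} \<subseteq> A" and e: "e > 0" for A x e
  proof -
    have "((\<lambda>t. ereal (- (\<bar>x\<bar> + e)\<^sup>2 / (2 * v t))) \<longlongrightarrow> ereal (- (\<bar>x\<bar> + e)\<^sup>2 / (2 * \<sigma>))) at_top"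
      using \<sigma> by (intro tendsto_intros v) auto
    then have "- ereal ((\<bar>x\<bar> + e)\<^sup>2 / (2 * \<sigma>)) = Liminf at_top (\<lambda>t. ereal (- (\<bar>x\<bar> + e)\<^sup>2 / (2 * v t)))"
      by (subst lim_imp_Liminf) auto
    also have "\<dots> \<le> Liminf at_top (?l A)"
    proof (rule Liminf_mono)
      have "((\<lambda>t. 2 * pi * (v t * (1 / s t))) \<longlongrightarrow> 2 * pi * (\<sigma> * 0)) at_top"
        by (intro tendsto_intros v inv)
      then have "\<forall>\<^sub>F t in at_top. 2 * pi * (v t * (1 / s t)) < (2 * e)\<^sup>2"
        using e by (intro order_tendstoD(2)[where y = "2 * pi * (\<sigma> * 0)"]) auto
      then show "\<forall>\<^sub>F t in at_top. ereal (- (\<bar>x\<bar> + e)\<^sup>2 / (2 * v t)) \<le> ?l A t"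
        using R ev
      proof eventually_elim
        case (elim t)
        then have st: "s t > 0" "v t > 0" by auto
        have "sqrt (2 * pi * (sqrt (v t / s t))\<^sup>2) < 2 * e"
          using elim(1) e st by (intro real_less_lsqrt) auto
        then have "1 \<le> 2 * e / sqrt (2 * pi * (sqrt (v t / s t))\<^sup>2)"
          using st by (subst le_divide_eq_1_pos) auto
        then have "1 * exp (- (\<bar>x\<bar> + e)\<^sup>2 / (2 * (sqrt (v t / s t))\<^sup>2))
            \<le> 2 * e / sqrt (2 * pi * (sqrt (v t / s t))\<^sup>2) * exp (- (\<bar>x\<bar> + e)\<^sup>2 / (2 * (sqrt (v t / s t))\<^sup>2))"
          by (rule mult_right_mono) simp
        also have "\<dots> \<le> prob {\<omega> \<in> space M. R t \<omega> \<in> A}"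
          using elim A e st by (intro normal_interval_ge[where \<tau> = "sqrt (v t / s t)"]) auto
        finally have "eln (exp (s t * (- (\<bar>x\<bar> + e)\<^sup>2 / (2 * v t)))) \<le> eln (prob {\<omega> \<in> space M. R t \<omega> \<in> A})"
          using st by (intro eln_mono) (simp add: mult.commute)
        then have "ereal (s t * (- (\<bar>x\<bar> + e)\<^sup>2 / (2 * v t))) / ereal (s t) \<le> ?l A t"
          using st by (intro ereal_divide_right_mono) (auto simp: eln_def)
        then show ?case using st by simp
      qed
    qed
    finally show ?thesis .
  qed
  \<comment> \<open>An interior point admits every small \<open>e\<close> in \<open>low_eps\<close>,
    and the lower limit does not depend on \<open>e\<close>; letting \<open>e\<close> tend to 0
    removes the loss.\<close>
  have low: "- ?I x \<le> Liminf at_top (?l A)" if A: "A \<in> sets borel" "x \<in> interior A" for A x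
  proof (rule tendsto_upperbound)
    show "((\<lambda>e. - ereal ((\<bar>x\<bar> + e)\<^sup>2 / (2 * \<sigma>))) \<longlongrightarrow> - ?I x) (at_right 0)"
    proof -
      have "((\<lambda>e. - ereal ((\<bar>x\<bar> + e)\<^sup>2 / (2 * \<sigma>))) \<longlongrightarrow> - ereal ((\<bar>x\<bar> + 0)\<^sup>2 / (2 * \<sigma>))) (at_right 0)"
        using \<sigma> by (intro tendsto_intros) auto
      then show ?thesis by simp
    qed
    obtain d where d: "d > 0" "ball x d \<subseteq> A" using A(2) by (auto simp: mem_interior)
    show "\<forall>\<^sub>F e in at_right 0. - ereal ((\<bar>x\<bar> + e)\<^sup>2 / (2 * \<sigma>)) \<le> Liminf at_top (?l A)"
      using eventually_at_right_less[of 0] eventually_at_right_real[OF d(1)]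
    proof eventually_elim
      case (elim e)
      have "{x - e<..<x + e} \<subseteq> ball x d" using elim by (auto simp: dist_real_def)
      then show ?case using elim d A(1) by (intro low_eps) auto
    qed
  qed simp
  show ?thesis
    unfolding LDP_def
  proof (intro conjI ballI)
    show "good_rate_function ?I" using \<sigma> by (intro good_rate_function_square) simp
    fix A :: "real set" assume A: "A \<in> sets borel"
    have "- Liminf at_top (?l A) \<le> (INF x\<in>interior A. ?I x)"
      by (rule INF_greatest, rule ereal_uminus_le_reorder[THEN iffD1], rule low[OF A])
    then show "- (INF x\<in>interior A. ?I x) \<le> Liminf at_top (?l A)"
      by (rule ereal_uminus_le_reorder[THEN iffD1])
    show "Limsup at_top (?l A) \<le> - (INF x\<in>closure A. ?I x)"
    proof (cases "A = {}")
      \<comment> \<open>Both sides are minus infinity here: \<open>eln 0\<close> is, and the infimum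
        over the empty set is plus infinity. A nearest point exists only in the other case.\<close>
      case True
      have "\<forall>\<^sub>F t in at_top. ?l A t \<le> - \<infinity>"
        using ev by eventually_elim (simp add: True eln_def)
      then have "Limsup at_top (?l A) \<le> - \<infinity>" by (intro Limsup_bounded) auto
      then show ?thesis by simp
    next
      case False
      then obtain m where m: "m \<in> closure A" "infdist 0 (closure A) = dist 0 m"
        using infdist_attains_inf[of "closure A" 0] by auto
      have "\<bar>m\<bar> \<le> \<bar>x\<bar>" if "x \<in> A" for x
        using infdist_le[of x "closure A" 0] m(2) that closure_subset[of A] by auto
      then have "Limsup at_top (?l A) \<le> - ?I m" by (intro up A)
      also have "\<dots> \<le> - (INF x\<in>closure A. ?I x)"
        using INF_lower[OF m(1), of ?I] by (simp only: ereal_minus_le_minus)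
      finally show ?thesis .
    qed
  qed
qed

section \<open>Characteristic functions of supOU processes\<close>

lemma nn_integral_exp_atMost:
  fixes c m :: real
  assumes c: "c > 0"
  shows "(\<integral>\<^sup>+s. ennreal (exp (c * s)) * indicator {..m} s \<partial>lborel) = ennreal (exp (c * m) / c)"
proof -
  have "(\<integral>\<^sup>+s. ennreal (exp (c * s)) * indicator {..m} s \<partial>lborel)
     = (\<integral>\<^sup>+s. ennreal (exp (- c * s)) * indicator {- m..} s \<partial>lborel)"
    by (subst nn_integral_real_affine[where c = "-1" and t = 0])
       (auto intro!: nn_integral_cong simp: indicator_def)
  also have "\<dots> = ennreal (0 - (- exp (- c * (- m)) / c))"
  proof (rule nn_integral_FTC_atLeast)
    have "((\<lambda>s. inverse (exp (c * s))) \<longlongrightarrow> 0) at_top"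
      using c by (intro tendsto_inverse_0_at_top filterlim_compose[OF exp_at_top]
          filterlim_tendsto_pos_mult_at_top[OF tendsto_const] filterlim_ident)
    from tendsto_mult_right_zero[OF this, of "- 1 / c"]
    show "((\<lambda>s. - exp (- c * s) / c) \<longlongrightarrow> 0) at_top" by (simp add: exp_minus)
  qed (use c in \<open>auto intro!: derivative_eq_intros\<close>)
  finally show ?thesis by simp
qed

lemma supOU_kernel_measurable [measurable]:
  assumes [measurable]: "f \<in> borel_measurable N" "g \<in> borel_measurable N" "h \<in> borel_measurable N"
  shows "(\<lambda>x. supOU_kernel (f x) (g x) (h x)) \<in> borel_measurable N"
  unfolding supOU_kernel_def by measurable

lemma supOU_kernel_nonneg: "0 \<le> supOU_kernel \<xi> s t"
  by (simp add: supOU_kernel_def)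

text \<open>Unit mass for every \<xi> and \<open>t\<close> is what makes the drift \<open>a\<close>
  the mean of each \<open>Y t\<close> in the Gaussian case.\<close>

lemma nn_integral_supOU_kernel: "(\<integral>\<^sup>+s. ennreal (supOU_kernel \<xi> s t) \<partial>lborel) = 1"
proof -
  have "(\<integral>\<^sup>+s. ennreal (supOU_kernel \<xi> s t) \<partial>lborel) =
     (\<integral>\<^sup>+s. ennreal (exp (- \<xi> * t)) * (ennreal (exp (1 * s)) * indicator {..\<xi> * t} s) \<partial>lborel)"
    by (intro nn_integral_cong)
       (auto simp: supOU_kernel_def indicator_def exp_add[symmetric] ennreal_mult[symmetric])
  also have "\<dots> = 1"
    by (subst nn_integral_cmult) (auto simp: nn_integral_exp_atMost[of 1, simplified] ennreal_mult[symmetric] simp flip: exp_add)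
  finally show ?thesis .
qed

text \<open>Both factors are nonzero only up to the smaller of the two endpoints
  \<open>\<xi> * t\<close> and \<open>\<xi> * u\<close>. Integrating \<open>exp (2 * s)\<close> up
  to it gives the 1/2, and the exponents combine to the covariance of an Ornstein-Uhlenbeck process
  of rate \<xi>.\<close>

lemma nn_integral_supOU_kernel_mult:
  "(\<integral>\<^sup>+s. ennreal (supOU_kernel \<xi> s t * supOU_kernel \<xi> s u) \<partial>lborel) = ennreal (exp (- \<bar>\<xi> * (t - u)\<bar>) / 2)"
proof -
  have "(\<integral>\<^sup>+s. ennreal (supOU_kernel \<xi> s t * supOU_kernel \<xi> s u) \<partial>lborel) =
     (\<integral>\<^sup>+s. ennreal (exp (- \<xi> * t - \<xi> * u)) * (ennreal (exp (2 * s)) * indicator {..min (\<xi> * t) (\<xi> * u)} s) \<partial>lborel)"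
    by (intro nn_integral_cong)
       (auto simp: supOU_kernel_def indicator_def exp_add[symmetric] ennreal_mult[symmetric] mult.commute)
  also have "\<dots> = ennreal (exp (- \<xi> * t - \<xi> * u)) * ennreal (exp (2 * min (\<xi> * t) (\<xi> * u)) / 2)"
    by (subst nn_integral_cmult) (auto simp: nn_integral_exp_atMost)
  also have "\<dots> = ennreal (exp (- \<xi> * t - \<xi> * u + 2 * min (\<xi> * t) (\<xi> * u)) / 2)"
    by (simp add: ennreal_mult[symmetric] exp_add)
  also have "- \<xi> * t - \<xi> * u + 2 * min (\<xi> * t) (\<xi> * u) = - \<bar>\<xi> * (t - u)\<bar>"
    by (simp add: min_def abs_if algebra_simps)
  finally show ?thesis .
qed

lemma has_bochner_integral_pair_lborel:
  fixes f :: "'a \<times> real \<Rightarrow> real"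
  assumes [measurable]: "f \<in> borel_measurable (N \<Otimes>\<^sub>M lborel)" and f: "\<And>z. f z \<ge> 0"
    and g: "\<And>x. (\<integral>\<^sup>+y. ennreal (f (x, y)) \<partial>lborel) = ennreal (g x)" "\<And>x. g x \<ge> 0" "integrable N g"
  shows "has_bochner_integral (N \<Otimes>\<^sub>M lborel) f (\<integral>x. g x \<partial>N)"
proof (rule has_bochner_integral_nn_integral)
  have "(\<integral>\<^sup>+z. ennreal (f z) \<partial>(N \<Otimes>\<^sub>M lborel)) = (\<integral>\<^sup>+x. \<integral>\<^sup>+y. ennreal (f (x, y)) \<partial>lborel \<partial>N)"
    by (subst lborel.nn_integral_fst[symmetric]) auto
  also have "\<dots> = ennreal (\<integral>x. g x \<partial>N)"
    unfolding g(1) using g by (intro nn_integral_eq_integral) auto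
  finally show "(\<integral>\<^sup>+z. ennreal (f z) \<partial>(N \<Otimes>\<^sub>M lborel)) = ennreal (\<integral>x. g x \<partial>N)" .
qed (use f g in auto)

lemma has_bochner_integral_supOU_kernel:
  fixes N :: "real measure"
  assumes "prob_space N" and [measurable_cong]: "sets N = sets borel"
  shows "has_bochner_integral (N \<Otimes>\<^sub>M lborel) (\<lambda>z. supOU_kernel (fst z) (snd z) t) 1"
proof -
  interpret prob_space N by fact
  show ?thesis
    using has_bochner_integral_pair_lborel[of "\<lambda>z. supOU_kernel (fst z) (snd z) t" N "\<lambda>_. 1"]
  by (simp add: supOU_kernel_nonneg nn_integral_supOU_kernel prob_space)
qed

lemma has_bochner_integral_supOU_kernel_mult:
  fixes N :: "real measure"
  assumes "prob_space N" and [measurable_cong]: "sets N = sets borel"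
  shows "has_bochner_integral (N \<Otimes>\<^sub>M lborel)
    (\<lambda>z. supOU_kernel (fst z) (snd z) t * supOU_kernel (fst z) (snd z) u)
    ((\<integral>\<xi>. exp (- \<bar>\<xi> * (t - u)\<bar>) \<partial>N) / 2)"
proof -
  interpret prob_space N by fact
  have "integrable N (\<lambda>\<xi>. exp (- \<bar>\<xi> * (t - u)\<bar>) / 2)"
    by (rule integrable_const_bound[where B = "1"])
       (auto intro!: AE_I2 order_trans[of "exp _" 1 2])
  then show ?thesis
    using has_bochner_integral_pair_lborel[of "\<lambda>z. supOU_kernel (fst z) (snd z) t * supOU_kernel (fst z) (snd z) u"
        N "\<lambda>\<xi>. exp (- \<bar>\<xi> * (t - u)\<bar>) / 2"]
    by (simp add: supOU_kernel_nonneg nn_integral_supOU_kernel_mult)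
qed

lemma kappa_L_gaussian:
  "kappa_L a b (null_measure borel) \<zeta> = \<i> * complex_of_real (\<zeta> * a) - complex_of_real (\<zeta>^2 * b / 2)"
  by (simp add: kappa_L_def)

text \<open>The drift term is linear in the kernels, each of mass 1; the Gaussian term is the square
  of their combination, expanded into pairs. In \<open>b / 4\<close> one half comes from
  \<open>kappa_L\<close> and one from the kernel products.\<close>

lemma integral_kappa_L_gaussian:
  fixes N :: "real measure" and n :: nat
  assumes N: "prob_space N" "sets N = sets borel"
  shows "(CLINT z|(N \<Otimes>\<^sub>M lborel). kappa_L a b (null_measure borel) (\<Sum>j<n. \<zeta> j * supOU_kernel (fst z) (snd z) (tt j)))
    = \<i> * complex_of_real ((\<Sum>j<n. \<zeta> j) * a) -
      complex_of_real (b / 4 * (\<Sum>j<n. \<Sum>k<n. \<zeta> j * \<zeta> k * (\<integral>\<xi>. exp (- \<bar>\<xi> * (tt j - tt k)\<bar>) \<partial>N)))"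
proof -
  let ?F = "\<lambda>z. \<Sum>j<n. \<zeta> j * supOU_kernel (fst z) (snd z) (tt j)"
  let ?Q = "\<Sum>j<n. \<Sum>k<n. \<zeta> j * \<zeta> k * ((\<integral>\<xi>. exp (- \<bar>\<xi> * (tt j - tt k)\<bar>) \<partial>N) / 2)"
  have 1: "has_bochner_integral (N \<Otimes>\<^sub>M lborel) ?F (\<Sum>j<n. \<zeta> j * 1)"
    by (intro has_bochner_integral_sum has_bochner_integral_mult_right has_bochner_integral_supOU_kernel N)
  have "has_bochner_integral (N \<Otimes>\<^sub>M lborel) (\<lambda>z. \<Sum>j<n. \<Sum>k<n. \<zeta> j * \<zeta> k *
      (supOU_kernel (fst z) (snd z) (tt j) * supOU_kernel (fst z) (snd z) (tt k))) ?Q"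
    by (intro has_bochner_integral_sum has_bochner_integral_mult_right has_bochner_integral_supOU_kernel_mult N)
  also have "(\<lambda>z. \<Sum>j<n. \<Sum>k<n. \<zeta> j * \<zeta> k *
      (supOU_kernel (fst z) (snd z) (tt j) * supOU_kernel (fst z) (snd z) (tt k))) = (\<lambda>z. (?F z)\<^sup>2)"
    by (simp add: power2_eq_square sum_product mult_ac)
  finally have 2: "has_bochner_integral (N \<Otimes>\<^sub>M lborel) (\<lambda>z. (?F z)\<^sup>2) ?Q" .
  have "has_bochner_integral (N \<Otimes>\<^sub>M lborel)
     (\<lambda>z. \<i> * complex_of_real (?F z * a) - complex_of_real ((?F z)\<^sup>2 * (b / 2)))
     (\<i> * complex_of_real ((\<Sum>j<n. \<zeta> j * 1) * a) - complex_of_real (?Q * (b / 2)))"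
    by (intro has_bochner_integral_diff has_bochner_integral_mult_right has_bochner_integral_of_real
        has_bochner_integral_mult_left 1 2)
  from has_bochner_integral_integral_eq[OF this] show ?thesis
    by (simp add: kappa_L_gaussian sum_divide_distrib[symmetric] mult.commute)
qed

text \<open>Standardising reduces the claim to the known characteristic function of the standard
  normal law, to which Levy's uniqueness theorem applies.\<close>

lemma (in prob_space) normal_if_char:
  assumes X[measurable]: "random_variable borel X" and \<tau>: "\<tau> > 0"
    and ch: "\<And>\<zeta>. (CLINT \<omega>|M. cis (\<zeta> * X \<omega>)) = cis (\<zeta> * m) * complex_of_real (exp (- (\<zeta> * \<tau>)\<^sup>2 / 2))"
  shows "distributed M lborel X (normal_density m \<tau>)"
proof -
  let ?Z = "\<lambda>\<omega>. (X \<omega> - m) / \<tau>"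
  have "char (distr M borel ?Z) = char std_normal_distribution"
  proof
    fix t
    have "char (distr M borel ?Z) t = (CLINT \<omega>|M. cis (t * ?Z \<omega>))"
      unfolding char_def by (subst integral_distr) (auto simp: cis_conv_exp)
    also have "\<dots> = (CLINT \<omega>|M. cis (- (t / \<tau> * m)) * cis (t / \<tau> * X \<omega>))"
      by (intro Bochner_Integration.integral_cong refl) (simp add: cis_mult diff_divide_distrib algebra_simps)
    also have "\<dots> = cis (- (t / \<tau> * m)) * (CLINT \<omega>|M. cis (t / \<tau> * X \<omega>))"
      by (simp only: integral_mult_right_zero)
    also have "\<dots> = (cis (- (t / \<tau> * m)) * cis (t / \<tau> * m)) * complex_of_real (exp (- (t / \<tau> * \<tau>)\<^sup>2 / 2))"
      by (simp only: ch mult.assoc)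
    also have "\<dots> = complex_of_real (exp (- t\<^sup>2 / 2))"
      using \<tau> by (simp add: cis_mult)
    finally show "char (distr M borel ?Z) t = char std_normal_distribution t"
      by (simp add: char_std_normal_distribution)
  qed
  then have "distr M borel ?Z = std_normal_distribution"
    by (intro Levy_uniqueness real_distribution_distr real_dist_normal_dist) auto
  then have "distributed M lborel ?Z std_normal_density"
    by (simp add: distributed_def cong: distr_cong)
  then show ?thesis
    using normal_standard_normal_convert[OF \<tau>] by simp
qed

text \<open>For \<open>V = 0\<close> the law is the point mass at 0 and there is no density, hence
  the case split. This case does occur, for \<open>Y u - Y (grid t n u)\<close> with
  \<open>u\<close> a mesh point.\<close>

lemma (in prob_space) abs_moment_if_char:
  assumes X[measurable]: "random_variable borel X" and V: "V \<ge> 0"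
    and ch: "\<And>\<zeta>. (CLINT \<omega>|M. cis (\<zeta> * X \<omega>)) = complex_of_real (exp (- \<zeta>\<^sup>2 * V / 2))"
  shows "has_bochner_integral M (\<lambda>\<omega>. \<bar>X \<omega>\<bar>) (sqrt V * sqrt (2 / pi))"
proof (cases "V = 0")
  case True
  have "char (distr M borel X) = char (return borel 0)"
    unfolding char_def using ch True
    by (auto simp: fun_eq_iff integral_distr integral_return cis_conv_exp)
  moreover have "real_distribution (return borel (0::real))"
    by (simp add: real_distribution_def real_distribution_axioms_def prob_space_return)
  ultimately have eq: "distr M borel X = return borel 0"
    by (intro Levy_uniqueness real_distribution_distr) auto
  have "has_bochner_integral (return borel 0) (\<lambda>x::real. \<bar>x\<bar>) 0"
    by (auto intro!: has_bochner_integral_nn_integral simp: nn_integral_return)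
  then show ?thesis
    unfolding eq[symmetric] using True by (simp add: has_bochner_integral_iff integrable_distr_eq integral_distr)
next
  case False
  then have "distributed M lborel X (normal_density 0 (sqrt V))"
    using V by (intro normal_if_char) (auto simp: ch power_mult_distrib)
  note D = this
  have N: "has_bochner_integral lborel (\<lambda>x. normal_density 0 (sqrt V) x * \<bar>x\<bar>) (sqrt V * sqrt (2 / pi))"
    using normal_moment_abs_odd[of "sqrt V" 0 0] V False by simp
  have "integrable M (\<lambda>\<omega>. \<bar>X \<omega>\<bar>)"
    using integrable.intros[OF N] by (subst distributed_integrable[OF D, symmetric]) auto
  moreover have "(\<integral>\<omega>. \<bar>X \<omega>\<bar> \<partial>M) = (\<integral>x. normal_density 0 (sqrt V) x * \<bar>x\<bar> \<partial>lborel)"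
    by (subst distributed_integral[OF D, symmetric]) auto
  ultimately show ?thesis
    using N by (simp only: has_bochner_integral_iff)
qed

section \<open>Riemann sums\<close>

lemma emeasure_Ioo_finite: "emeasure lborel {a<..<b::real} < \<infinity>"
  by (cases "a \<le> b") auto

lemma integrable_indicator_Ioo: "integrable lborel (indicator {a<..<b::real} :: real \<Rightarrow> real)"
  by (intro integrable_real_indicator emeasure_Ioo_finite) simp

lemma cis_measurable [measurable (raw)]:
  "f \<in> borel_measurable N \<Longrightarrow> (\<lambda>x. cis (f x)) \<in> borel_measurable N"
  unfolding cis_conv_exp by measurable

text \<open>Rounds \<open>u\<close> down to the mesh of width \<open>t / n\<close>. A left-endpoint
  Riemann sum becomes the integral of the function composed with \<open>grid t n\<close>, so sum and
  integral can be compared under one integral sign.\<close>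

definition grid :: "real \<Rightarrow> nat \<Rightarrow> real \<Rightarrow> real" where
  "grid t n u = of_int \<lfloor>u * real n / t\<rfloor> * t / real n"

lemma grid_measurable [measurable]: "grid t n \<in> borel_measurable borel"
  unfolding grid_def[abs_def] by measurable

lemma grid_le:
  assumes "t > 0" "n > 0"
  shows "grid t n u \<le> u"
proof -
  have "of_int \<lfloor>u * real n / t\<rfloor> * (t / real n) \<le> (u * real n / t) * (t / real n)"
    using assms by (intro mult_right_mono of_int_floor_le) simp
  then show ?thesis using assms by (simp add: grid_def)
qed

lemma grid_gt:
  assumes "t > 0" "n > 0"
  shows "u - t / real n < grid t n u"
proof -
  have "u * real n / t < of_int \<lfloor>u * real n / t\<rfloor> + 1" by linarith
  then have "(u * real n / t) * (t / real n) < (of_int \<lfloor>u * real n / t\<rfloor> + 1) * (t / real n)"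
    using assms by (intro mult_strict_right_mono) simp_all
  then show ?thesis using assms by (simp add: grid_def distrib_right add_divide_distrib)
qed

lemma grid_nonneg: "t > 0 \<Longrightarrow> u \<ge> 0 \<Longrightarrow> 0 \<le> grid t n u"
  by (simp add: grid_def)

lemma grid_tendsto:
  assumes t: "t > 0"
  shows "(\<lambda>n. grid t n u) \<longlonglongrightarrow> u"
proof (rule tendsto_sandwich[OF _ _ _ tendsto_const])
  have "(\<lambda>n. u - t / real n) \<longlonglongrightarrow> u - 0"
    by (intro tendsto_diff tendsto_const lim_const_over_n)
  then show "(\<lambda>n. u - t / real n) \<longlonglongrightarrow> u" by simp
  show "\<forall>\<^sub>F n in sequentially. u - t / real n \<le> grid t n u"
    using eventually_gt_at_top[of 0] by eventually_elim (simp add: less_imp_le grid_gt t)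
  show "\<forall>\<^sub>F n in sequentially. grid t n u \<le> u"
    using eventually_gt_at_top[of 0] by eventually_elim (simp add: grid_le t)
qed

lemma has_bochner_integral_grid:
  fixes h :: "real \<Rightarrow> real"
  assumes t: "t > 0" and n: "n > 0"
  shows "has_bochner_integral lborel (\<lambda>u. indicator {0<..<t} u * h (grid t n u))
    (t / real n * (\<Sum>j<n. h (real j * t / real n)))"
proof -
  define J where "J j = {real j * t / real n..<(real j + 1) * t / real n}" for j :: nat
  have J_le: "real j * t / real n \<le> (real j + 1) * t / real n" for j
    using t by (intro divide_right_mono mult_right_mono) auto
  have "has_bochner_integral lborel (\<lambda>u. \<Sum>j<n. h (real j * t / real n) * indicator (J j) u)
     (\<Sum>j<n. h (real j * t / real n) * measure lborel (J j))"
    by (intro has_bochner_integral_sum has_bochner_integral_mult_right has_bochner_integral_real_indicator)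
       (auto simp: J_def emeasure_lborel_Ico[OF J_le])
  moreover have "measure lborel (J j) = t / real n" for j
    using t n by (simp add: J_def field_simps)
  ultimately have "has_bochner_integral lborel (\<lambda>u. \<Sum>j<n. h (real j * t / real n) * indicator (J j) u)
     (t / real n * (\<Sum>j<n. h (real j * t / real n)))"
    by (simp add: sum_distrib_left mult.commute)
  \<comment> \<open>The cells \<open>J j\<close> with \<open>j < n\<close> partition
    \<open>{0..<t}\<close>, so only the endpoint \<open>u = 0\<close> is missing from the open
    interval.\<close>
  moreover have "(\<Sum>j<n. h (real j * t / real n) * indicator (J j) u) = indicator {0<..<t} u * h (grid t n u)"
    if "u \<notin> {0}" for u
  proof (cases "0 < u \<and> u < t")
    case True
    define m where "m = nat \<lfloor>u * real n / t\<rfloor>"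
    have m: "real m = of_int \<lfloor>u * real n / t\<rfloor>" using True t by (simp add: m_def)
    have "u * real n / t < real n" using True t n by (simp add: field_simps)
    then have mn: "m < n" using m by linarith
    have iff: "u \<in> J j \<longleftrightarrow> j = m" for j
    proof -
      have "u \<in> J j \<longleftrightarrow> real j \<le> u * real n / t \<and> u * real n / t < real j + 1"
        using t n by (simp add: J_def field_simps)
      also have "\<dots> \<longleftrightarrow> j = m" using m by linarith
      finally show ?thesis .
    qed
    have "(\<Sum>j<n. h (real j * t / real n) * indicator (J j) u) = (\<Sum>j<n. if j = m then h (real m * t / real n) else 0)"
      by (intro sum.cong refl) (auto simp: indicator_def iff)
    also have "\<dots> = h (grid t n u)" using mn by (simp add: grid_def m)
    finally show ?thesis using True by simp
  next
    case False
    have "u \<notin> J j" if "j < n" for j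
    proof
      assume u: "u \<in> J j"
      have "(real j + 1) * t \<le> t * real n"
        using t that by (subst mult.commute, intro mult_left_mono) auto
      then have "(real j + 1) * t / real n \<le> t" using n by (subst pos_divide_le_eq) auto
      moreover have "0 \<le> real j * t / real n" using t by simp
      ultimately show False using u False \<open>u \<notin> {0}\<close> by (auto simp: J_def)
    qed
    then show ?thesis using False by (auto simp: indicator_def)
  qed
  ultimately show ?thesis
    by (subst has_bochner_integral_discrete_difference[of "{0}",
          where g = "\<lambda>u. \<Sum>j<n. h (real j * t / real n) * indicator (J j) u"]) auto
qed

lemma riemann_sum_tendsto:
  fixes h :: "real \<Rightarrow> real"
  assumes t: "t > 0" and h: "continuous_on UNIV h" and B: "\<And>u. 0 \<le> u \<Longrightarrow> u \<le> t \<Longrightarrow> \<bar>h u\<bar> \<le> B"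
  shows "(\<lambda>n. t / real n * (\<Sum>j<n. h (real j * t / real n))) \<longlonglongrightarrow> (\<integral>u. indicator {0<..<t} u * h u \<partial>lborel)"
proof -
  have [measurable]: "h \<in> borel_measurable borel"
    using h by (rule borel_measurable_continuous_onI)
  have "(\<lambda>n. \<integral>u. indicator {0<..<t} u * h (grid t n u) \<partial>lborel) \<longlonglongrightarrow> (\<integral>u. indicator {0<..<t} u * h u \<partial>lborel)"
  proof (rule integral_dominated_convergence[where w = "\<lambda>u. B * indicator {0<..<t} u"])
    show "AE u in lborel. (\<lambda>n. indicator {0<..<t} u * h (grid t n u)) \<longlonglongrightarrow> indicator {0<..<t} u * h u"
    proof (rule AE_I2)
      fix u
      have "isCont h u" using h by (simp add: continuous_on_eq_continuous_at)
      then show "(\<lambda>n. indicator {0<..<t} u * h (grid t n u)) \<longlonglongrightarrow> indicator {0<..<t} u * h u"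
        by (intro tendsto_mult tendsto_const isCont_tendsto_compose[of u h] grid_tendsto t)
    qed
    show "AE u in lborel. norm (indicator {0<..<t} u * h (grid t n u)) \<le> B * indicator {0<..<t} u" for n
    proof (rule AE_I2)
      fix u
      show "norm (indicator {0<..<t} u * h (grid t n u)) \<le> B * indicator {0<..<t} u"
      proof (cases "u \<in> {0<..<t}")
        case True
        \<comment> \<open>The majorant is required for \<open>n = 0\<close> too; there division by
          zero makes \<open>grid\<close> equal to 0.\<close>
        then have "grid t n u \<le> t"
          using grid_le[OF t, of n u] t by (cases "n = 0") (auto simp: grid_def)
        then show ?thesis using True grid_nonneg[OF t, of u n] B by simp
      qed simp
    qed
    show "integrable lborel (\<lambda>u. B * indicator {0<..<t} u)"
      by (intro integrable_mult_right integrable_indicator_Ioo)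
  qed measurable
  moreover have "\<forall>\<^sub>F n in sequentially. (\<integral>u. indicator {0<..<t} u * h (grid t n u) \<partial>lborel)
      = t / real n * (\<Sum>j<n. h (real j * t / real n))"
    using eventually_gt_at_top[of 0]
    by eventually_elim (rule has_bochner_integral_integral_eq[OF has_bochner_integral_grid[OF t]])
  ultimately show ?thesis by (rule Lim_transform_eventually)
qed

text \<open>Pairs are counted by their lag: lag \<open>d > 0\<close> occurs \<open>n - d\<close>
  times in each direction. Lag 0 occurs only \<open>n\<close> times, but doubling counts it twice,
  hence the correction.\<close>

lemma sum_sum_even_diff:
  fixes f :: "real \<Rightarrow> real"
  assumes f: "\<And>x. f (- x) = f x"
  shows "(\<Sum>j<n. \<Sum>k<n. f (real j - real k)) = 2 * (\<Sum>d<n. (real n - real d) * f (real d)) - real n * f 0"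
proof (induction n)
  case (Suc n)
  have *: "(\<Sum>k<n. f (real n - real k)) = (\<Sum>d<n. f (real d)) + f (real n) - f 0"
  proof -
    have "(\<Sum>k<n. f (real n - real k)) = (\<Sum>k<n. f (real (Suc (n - Suc k))))"
      by (intro sum.cong refl) (auto simp: Suc_diff_Suc of_nat_diff)
    also have "\<dots> = (\<Sum>k<n. f (real (Suc k)))"
      by (rule sum.nat_diff_reindex)
    also have "\<dots> = (\<Sum>d<Suc n. f (real d)) - f 0"
      by (subst sum.lessThan_Suc_shift) simp
    finally show ?thesis by simp
  qed
  have "f (real j - real n) = f (real n - real j)" for j :: nat
    using f[of "real j - real n"] by simp
  then have "(\<Sum>j<Suc n. \<Sum>k<Suc n. f (real j - real k))
     = (\<Sum>j<n. \<Sum>k<n. f (real j - real k)) + 2 * (\<Sum>k<n. f (real n - real k)) + f 0"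
    by (simp add: sum.distrib)
  also have "\<dots> = 2 * (\<Sum>d<n. (real n - real d) * f (real d)) + 2 * ((\<Sum>d<n. f (real d)) + f (real n) - f 0) + f 0 - real n * f 0"
    by (simp add: Suc.IH *)
  also have "(\<Sum>d<n. (real n - real d) * f (real d)) + ((\<Sum>d<n. f (real d)) + f (real n)) = (\<Sum>d<Suc n. (real (Suc n) - real d) * f (real d))"
    by (simp add: sum.distrib[symmetric] algebra_simps)
  then have "2 * (\<Sum>d<n. (real n - real d) * f (real d)) + 2 * ((\<Sum>d<n. f (real d)) + f (real n) - f 0) + f 0 - real n * f 0
     = 2 * (\<Sum>d<Suc n. (real (Suc n) - real d) * f (real d)) - real (Suc n) * f 0"
    by (simp add: algebra_simps)
  finally show ?case .
qed simp

text \<open>Sorting by lag leaves twice a single Riemann sum for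
  \<open>(t - u) * exp (- \<xi> * u)\<close>; the diagonal correction is
  \<open>t\<^sup>2 / n\<close> and vanishes in the limit.\<close>

lemma exp_double_riemann_sum_tendsto:
  assumes \<xi>: "\<xi> > 0" and t: "t > 0"
  shows "(\<lambda>n. (t / real n)\<^sup>2 * (\<Sum>j<n. \<Sum>k<n. exp (- \<bar>\<xi> * (real j * t / real n - real k * t / real n)\<bar>)))
    \<longlonglongrightarrow> 2 * t\<^sup>2 * ou_kernel (\<xi> * t)"
proof -
  define h where "h u = (t - u) * exp (- \<xi> * u)" for u
  have hb: "\<bar>h u\<bar> \<le> t" if "0 \<le> u" "u \<le> t" for u
  proof -
    have "(t - u) * exp (- \<xi> * u) \<le> t * 1" using that \<xi> by (intro mult_mono) auto
    then show ?thesis using that by (simp add: h_def abs_mult)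
  qed
  have hc: "continuous_on UNIV h" unfolding h_def by (intro continuous_intros)
  have "has_bochner_integral lborel (\<lambda>u. h u * indicator {0..t} u) (t\<^sup>2 * ou_kernel (\<xi> * t))"
    using has_bochner_integral_exp_weighted[of \<xi> t] \<xi> t by (simp add: h_def)
  then have "has_bochner_integral lborel (\<lambda>u. indicator {0<..<t} u * h u) (t\<^sup>2 * ou_kernel (\<xi> * t))"
    by (subst has_bochner_integral_discrete_difference[of "{0, t}", where g = "\<lambda>u. h u * indicator {0..t} u"])
       (auto simp: indicator_def)
  then have lim: "(\<lambda>n. t / real n * (\<Sum>j<n. h (real j * t / real n))) \<longlonglongrightarrow> t\<^sup>2 * ou_kernel (\<xi> * t)"
    using riemann_sum_tendsto[OF t hc hb] by (simp add: has_bochner_integral_integral_eq)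
  have "(\<lambda>n. 2 * (t / real n * (\<Sum>j<n. h (real j * t / real n))) - t\<^sup>2 / real n)
    \<longlonglongrightarrow> 2 * (t\<^sup>2 * ou_kernel (\<xi> * t)) - 0"
    by (intro tendsto_diff tendsto_mult tendsto_const lim lim_const_over_n)
  moreover have "2 * (t / real n * (\<Sum>j<n. h (real j * t / real n))) - t\<^sup>2 / real n
     = (t / real n)\<^sup>2 * (\<Sum>j<n. \<Sum>k<n. exp (- \<bar>\<xi> * (real j * t / real n - real k * t / real n)\<bar>))" for n
  proof (cases "n = 0")
    case False
    define S where "S = (\<Sum>d<n. h (real d * t / real n))"
    define f where "f x = exp (- \<bar>\<xi> * (x * t / real n)\<bar>)" for x
    have "(\<Sum>j<n. \<Sum>k<n. exp (- \<bar>\<xi> * (real j * t / real n - real k * t / real n)\<bar>))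
      = (\<Sum>j<n. \<Sum>k<n. f (real j - real k))"
      by (simp add: f_def diff_divide_distrib left_diff_distrib)
    also have "\<dots> = 2 * (\<Sum>d<n. (real n - real d) * f (real d)) - real n * f 0"
      by (rule sum_sum_even_diff) (simp add: f_def)
    also have "(\<Sum>d<n. (real n - real d) * f (real d)) = (\<Sum>d<n. real n / t * h (real d * t / real n))"
    proof (rule sum.cong[OF refl])
      fix d
      have "\<bar>\<xi> * (real d * t / real n)\<bar> = \<xi> * (real d * t / real n)" using \<xi> t by simp
      then show "(real n - real d) * f (real d) = real n / t * h (real d * t / real n)"
        using t False by (simp add: f_def h_def field_simps)
    qed
    also have "\<dots> = real n / t * S" by (simp add: S_def sum_distrib_left)
    finally have eq: "(\<Sum>j<n. \<Sum>k<n. exp (- \<bar>\<xi> * (real j * t / real n - real k * t / real n)\<bar>))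
      = 2 * (real n / t * S) - real n * f 0" .
    have "2 * (t / real n * S) - t\<^sup>2 / real n = (t / real n)\<^sup>2 * (2 * (real n / t * S) - real n * f 0)"
      using t False by (simp add: f_def power2_eq_square field_simps)
    then show ?thesis unfolding eq S_def .
  qed simp
  ultimately show ?thesis by (simp add: mult.assoc)
qed

lemma norm_cis_diff_le: "norm (cis x - cis y) \<le> \<bar>x - y\<bar>"
proof -
  have "norm (cis x - cis y) = norm (cis y * (cis (x - y) - 1))"
    by (simp add: algebra_simps cis_mult)
  also have "\<dots> = norm (iexp (x - y) - 1)" by (simp add: norm_mult cis_conv_exp)
  also have "\<dots> \<le> \<bar>x - y\<bar>" using iexp_approx1[of "x - y" 0] by simp
  finally show ?thesis .
qed

section \<open>The integrated process\<close>

text \<open>The Levy basis is gone: \<open>char_sum\<close> retains only the covariance structure.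
  \<open>AE_pos\<close> keeps \<pi> away from \<xi> = 0, where the value of \<open>ou_kernel\<close>
  is not the limit of the Riemann sums.\<close>

locale gaussian_supOU = prob_space M for M :: "'w measure" +
  fixes Y :: "real \<Rightarrow> 'w \<Rightarrow> real" and b :: real and \<pi> :: "real measure"
  assumes b_pos: "b > 0" and prob_space_\<pi>: "prob_space \<pi>" and sets_\<pi> [measurable_cong]: "sets \<pi> = sets borel"
    and AE_pos: "AE \<xi> in \<pi>. 0 < \<xi>"
    and Y_measurable: "(\<lambda>(t, \<omega>). Y t \<omega>) \<in> borel_measurable (lborel \<Otimes>\<^sub>M M)"
    and char_sum: "(CLINT \<omega>|M. cis (\<Sum>j<n::nat. \<zeta> j * Y (tt j) \<omega>)) =
      complex_of_real (exp (- (b / 4 * (\<Sum>j<n. \<Sum>k<n. \<zeta> j * \<zeta> k * (\<integral>\<xi>. exp (- \<bar>\<xi> * (tt j - tt k)\<bar>) \<partial>\<pi>)))))"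
begin

sublocale \<pi>: prob_space \<pi> by (rule prob_space_\<pi>)

lemma Y_measurable' [measurable (raw)]:
  assumes [measurable]: "f \<in> borel_measurable N" "g \<in> measurable N M"
  shows "(\<lambda>x. Y (f x) (g x)) \<in> borel_measurable N"
  using measurable_compose[of "\<lambda>x. (f x, g x)" N "lborel \<Otimes>\<^sub>M M", OF _ Y_measurable] by simp

definition corr :: "real \<Rightarrow> real" where
  "corr \<tau> = (\<integral>\<xi>. exp (- \<bar>\<xi> * \<tau>\<bar>) \<partial>\<pi>)"

lemma integrable_exp_abs: "integrable \<pi> (\<lambda>\<xi>. exp (- \<bar>\<xi> * \<tau>\<bar>))"
  by (rule \<pi>.integrable_const_bound[where B = 1]) auto

lemma corr_0: "corr 0 = 1"
  by (simp add: corr_def \<pi>.prob_space)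

lemma corr_minus: "corr (- \<tau>) = corr \<tau>"
  by (simp add: corr_def)

lemma corr_nonneg: "0 \<le> corr \<tau>"
  by (simp add: corr_def)

lemma corr_le_1: "corr \<tau> \<le> 1"
  unfolding corr_def by (rule \<pi>.integral_le_const[OF integrable_exp_abs]) auto

lemma corr_measurable [measurable]: "corr \<in> borel_measurable borel"
  unfolding corr_def[abs_def] by measurable

text \<open>Combined with \<open>abs_moment_diff\<close>, this is continuity of \<open>Y\<close> in
  the mean, which replaces any regularity of paths.\<close>

lemma corr_tendsto_1:
  assumes "\<tau> \<longlonglongrightarrow> 0"
  shows "(\<lambda>n. corr (\<tau> n)) \<longlonglongrightarrow> 1"
proof -
  have "(\<lambda>n. corr (\<tau> n)) \<longlonglongrightarrow> (\<integral>\<xi>. 1 \<partial>\<pi>)"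
    unfolding corr_def
  proof (rule integral_dominated_convergence[where w = "\<lambda>_. 1"])
    show "AE \<xi> in \<pi>. (\<lambda>n. exp (- \<bar>\<xi> * \<tau> n\<bar>)) \<longlonglongrightarrow> 1"
    proof (rule AE_I2)
      fix \<xi>
      have "(\<lambda>n. exp (- \<bar>\<xi> * \<tau> n\<bar>)) \<longlonglongrightarrow> exp (- \<bar>\<xi> * 0\<bar>)"
        by (intro tendsto_intros assms)
      then show "(\<lambda>n. exp (- \<bar>\<xi> * \<tau> n\<bar>)) \<longlonglongrightarrow> 1" by simp
    qed
  qed auto
  then show ?thesis by (simp add: \<pi>.prob_space)
qed

lemma abs_moment: "has_bochner_integral M (\<lambda>\<omega>. \<bar>Y u \<omega>\<bar>) (sqrt (b / 2) * sqrt (2 / pi))"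
proof (rule abs_moment_if_char)
  show "(CLINT \<omega>|M. cis (\<zeta> * Y u \<omega>)) = complex_of_real (exp (- \<zeta>\<^sup>2 * (b / 2) / 2))" for \<zeta>
    using char_sum[of "\<lambda>_. \<zeta>" "\<lambda>_. u" 1]
    by (simp add: \<pi>.prob_space power2_eq_square mult.commute)
qed (use b_pos in auto)

text \<open>The difference is the linear combination with coefficients \<zeta> and -\<zeta>. Its
  variance is twice \<open>b / 2\<close> minus twice the covariance
  \<open>b / 2 * corr (u - v)\<close>.\<close>

lemma abs_moment_diff:
  "has_bochner_integral M (\<lambda>\<omega>. \<bar>Y u \<omega> - Y v \<omega>\<bar>) (sqrt (b * (1 - corr (u - v))) * sqrt (2 / pi))"
proof (rule abs_moment_if_char)
  fix \<zeta>
  have "(CLINT \<omega>|M. cis (\<zeta> * (Y u \<omega> - Y v \<omega>)))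
    = (CLINT \<omega>|M. cis (\<Sum>j<2::nat. (if j = 0 then \<zeta> else - \<zeta>) * Y (if j = 0 then u else v) \<omega>))"
    by (simp add: numeral_2_eq_2 algebra_simps)
  also have "\<dots> = complex_of_real (exp (- \<zeta>\<^sup>2 * (b * (1 - corr (u - v))) / 2))"
  proof -
    have eq: "(\<Sum>j<2::nat. \<Sum>k<2::nat. (if j = 0 then \<zeta> else - \<zeta>) * (if k = 0 then \<zeta> else - \<zeta>) *
        corr ((if j = 0 then u else v) - (if k = 0 then u else v))) = \<zeta>\<^sup>2 * (2 * (1 - corr (u - v)))"
      using corr_minus[of "u - v"] by (simp add: numeral_2_eq_2 corr_0 power2_eq_square algebra_simps)
    then show ?thesis
      unfolding char_sum corr_def[symmetric] eq by (simp add: field_simps)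
  qed
  finally show "(CLINT \<omega>|M. cis (\<zeta> * (Y u \<omega> - Y v \<omega>)))
    = complex_of_real (exp (- \<zeta>\<^sup>2 * (b * (1 - corr (u - v))) / 2))" .
qed (use b_pos corr_le_1 in auto)

text \<open>The open interval is the one over which \<open>LBINT u=0..t\<close> integrates for
  \<open>t > 0\<close>. Paths that are not integrable there get the default value 0; by
  \<open>AE_integrable_path\<close> they form a null set.\<close>

definition integrated :: "real \<Rightarrow> 'w \<Rightarrow> real" where
  "integrated t \<omega> = (\<integral>u. indicator {0<..<t} u * Y u \<omega> \<partial>lborel)"

definition integrated_var :: "real \<Rightarrow> real" where
  "integrated_var t = b * t\<^sup>2 * (\<integral>\<xi>. ou_kernel (\<xi> * t) \<partial>\<pi>)"

definition riemann :: "real \<Rightarrow> nat \<Rightarrow> 'w \<Rightarrow> real" where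
  "riemann t n \<omega> = t / real n * (\<Sum>j<n. Y (real j * t / real n) \<omega>)"

lemma integrated_measurable [measurable]: "integrated t \<in> borel_measurable M"
  unfolding integrated_def[abs_def] by measurable

lemma riemann_measurable [measurable]: "riemann t n \<in> borel_measurable M"
  unfolding riemann_def[abs_def] by measurable

lemma nn_integral_swap:
  assumes [measurable]: "(\<lambda>(u, \<omega>). f u \<omega>) \<in> borel_measurable (lborel \<Otimes>\<^sub>M M)"
  shows "(\<integral>\<^sup>+\<omega>. \<integral>\<^sup>+u. f u \<omega> \<partial>lborel \<partial>M) = (\<integral>\<^sup>+u. \<integral>\<^sup>+\<omega>. f u \<omega> \<partial>M \<partial>lborel)"
proof -
  interpret pair_sigma_finite lborel M ..
  show ?thesis using Fubini[of "\<lambda>(u, \<omega>). f u \<omega>"] by simp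
qed

text \<open>By Tonelli the expected integral of the absolute value is the constant first absolute
  moment times the length of the interval, hence finite.\<close>

lemma AE_integrable_path: "AE \<omega> in M. integrable lborel (\<lambda>u. indicator {0<..<t} u * Y u \<omega>)"
proof -
  let ?c = "sqrt (b / 2) * sqrt (2 / pi)"
  have "(\<integral>\<^sup>+\<omega>. \<integral>\<^sup>+u. indicator {0<..<t} u * ennreal \<bar>Y u \<omega>\<bar> \<partial>lborel \<partial>M)
     = (\<integral>\<^sup>+u. \<integral>\<^sup>+\<omega>. indicator {0<..<t} u * ennreal \<bar>Y u \<omega>\<bar> \<partial>M \<partial>lborel)"
    by (rule nn_integral_swap) measurable
  also have "\<dots> = (\<integral>\<^sup>+u. indicator {0<..<t} u * ennreal ?c \<partial>lborel)"
    using abs_moment b_pos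
    by (subst nn_integral_cmult) (auto simp: nn_integral_eq_integral has_bochner_integral_iff)
  also have "\<dots> < \<infinity>"
    using emeasure_Ioo_finite[of 0 t]
    by (subst nn_integral_multc) (auto simp: ennreal_mult_less_top)
  finally have "AE \<omega> in M. (\<integral>\<^sup>+u. indicator {0<..<t} u * ennreal \<bar>Y u \<omega>\<bar> \<partial>lborel) \<noteq> \<infinity>"
    by (intro nn_integral_PInf_AE) auto
  with AE_space show ?thesis
  proof eventually_elim
    case (elim \<omega>)
    show ?case
    proof (rule integrableI_bounded)
      have "(\<integral>\<^sup>+u. ennreal (norm (indicator {0<..<t} u * Y u \<omega>)) \<partial>lborel)
         = (\<integral>\<^sup>+u. indicator {0<..<t} u * ennreal \<bar>Y u \<omega>\<bar> \<partial>lborel)"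
        by (intro nn_integral_cong) (auto simp: indicator_def)
      then show "(\<integral>\<^sup>+u. ennreal (norm (indicator {0<..<t} u * Y u \<omega>)) \<partial>lborel) < \<infinity>"
        using elim by (simp add: less_top)
    qed (measurable, rule elim(1))
  qed
qed

text \<open>The integrand is the first absolute moment of \<open>Y u - Y (grid t n u)\<close>; the
  integral bounds the mean error of the Riemann sum.\<close>

definition mesh_error :: "real \<Rightarrow> nat \<Rightarrow> real" where
  "mesh_error t n = (\<integral>u. indicator {0<..<t} u * (sqrt (b * (1 - corr (u - grid t n u))) * sqrt (2 / pi)) \<partial>lborel)"

lemma mesh_bound: "norm (indicator A u * (sqrt (b * (1 - corr x)) * sqrt (2 / pi)))
    \<le> sqrt b * sqrt (2 / pi) * indicator A u"
proof -
  have "sqrt (b * (1 - corr x)) \<le> sqrt (b * 1)"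
    using b_pos corr_nonneg[of x] by (intro real_sqrt_le_mono mult_left_mono) auto
  then show ?thesis
    using b_pos corr_le_1[of x] by (auto simp: indicator_def abs_mult intro!: mult_right_mono)
qed

lemma integrable_mesh:
  "integrable lborel (\<lambda>u. indicator {0<..<t} u * (sqrt (b * (1 - corr (u - grid t n u))) * sqrt (2 / pi)))"
proof (rule Bochner_Integration.integrable_bound)
  show "integrable lborel (\<lambda>u. sqrt b * sqrt (2 / pi) * indicator {0<..<t} u)"
    by (intro integrable_mult_right integrable_indicator_Ioo)
  show "AE u in lborel. norm (indicator {0<..<t} u * (sqrt (b * (1 - corr (u - grid t n u))) * sqrt (2 / pi)))
      \<le> norm (sqrt b * sqrt (2 / pi) * indicator {0<..<t} u :: real)"
    using b_pos by (intro AE_I2 order_trans[OF mesh_bound]) auto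
qed measurable

lemma mesh_error_tendsto_0:
  assumes t: "t > 0"
  shows "mesh_error t \<longlonglongrightarrow> 0"
proof -
  have "(\<lambda>n. mesh_error t n) \<longlonglongrightarrow> integral\<^sup>L lborel (\<lambda>u::real. 0::real)"
    unfolding mesh_error_def
  proof (rule integral_dominated_convergence[where w = "\<lambda>u. sqrt b * sqrt (2 / pi) * indicator {0<..<t} u"])
    show "integrable lborel (\<lambda>u. sqrt b * sqrt (2 / pi) * indicator {0<..<t} u)"
      by (intro integrable_mult_right integrable_indicator_Ioo)
    show "AE u in lborel. (\<lambda>n. indicator {0<..<t} u * (sqrt (b * (1 - corr (u - grid t n u))) * sqrt (2 / pi))) \<longlonglongrightarrow> 0"
    proof (rule AE_I2)
      fix u
      have "(\<lambda>n. u - grid t n u) \<longlonglongrightarrow> u - u" by (intro tendsto_intros grid_tendsto t)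
      then have "(\<lambda>n. corr (u - grid t n u)) \<longlonglongrightarrow> 1" by (intro corr_tendsto_1) simp
      then have "(\<lambda>n. indicator {0<..<t} u * (sqrt (b * (1 - corr (u - grid t n u))) * sqrt (2 / pi)))
         \<longlonglongrightarrow> indicator {0<..<t} u * (sqrt (b * (1 - 1)) * sqrt (2 / pi))"
        by (intro tendsto_intros)
      then show "(\<lambda>n. indicator {0<..<t} u * (sqrt (b * (1 - corr (u - grid t n u))) * sqrt (2 / pi))) \<longlonglongrightarrow> 0"
        by simp
    qed
    show "AE u in lborel. norm (indicator {0<..<t} u * (sqrt (b * (1 - corr (u - grid t n u))) * sqrt (2 / pi)))
      \<le> sqrt b * sqrt (2 / pi) * indicator {0<..<t} u" for n
      by (rule AE_I2[OF mesh_bound])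
  qed measurable
  then show ?thesis by simp
qed

text \<open>Almost surely the difference is one integral of \<open>Y u - Y (grid t n u)\<close> over
  the interval. The absolute value is taken inside, and Tonelli then reduces the claim to the
  moments of increments.\<close>

lemma integrated_minus_riemann:
  assumes t: "t > 0" and n: "n > 0"
  shows "(\<integral>\<^sup>+\<omega>. ennreal \<bar>integrated t \<omega> - riemann t n \<omega>\<bar> \<partial>M) \<le> ennreal (mesh_error t n)"
proof -
  have "(\<integral>\<^sup>+\<omega>. ennreal \<bar>integrated t \<omega> - riemann t n \<omega>\<bar> \<partial>M)
     \<le> (\<integral>\<^sup>+\<omega>. \<integral>\<^sup>+u. indicator {0<..<t} u * ennreal \<bar>Y u \<omega> - Y (grid t n u) \<omega>\<bar> \<partial>lborel \<partial>M)"
  proof (rule nn_integral_mono_AE)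
    show "AE \<omega> in M. ennreal \<bar>integrated t \<omega> - riemann t n \<omega>\<bar>
        \<le> (\<integral>\<^sup>+u. indicator {0<..<t} u * ennreal \<bar>Y u \<omega> - Y (grid t n u) \<omega>\<bar> \<partial>lborel)"
      using AE_integrable_path[of t]
    proof eventually_elim
      case (elim \<omega>)
      note R = has_bochner_integral_grid[OF t n, of "\<lambda>u. Y u \<omega>"]
      have "integrated t \<omega> - riemann t n \<omega>
         = (\<integral>u. indicator {0<..<t} u * Y u \<omega> - indicator {0<..<t} u * Y (grid t n u) \<omega> \<partial>lborel)"
        using elim R by (simp add: integrated_def riemann_def has_bochner_integral_iff)
      then have "ennreal \<bar>integrated t \<omega> - riemann t n \<omega>\<bar>
        \<le> (\<integral>\<^sup>+u. ennreal (norm (indicator {0<..<t} u * Y u \<omega> - indicator {0<..<t} u * Y (grid t n u) \<omega>)) \<partial>lborel)"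
        using integral_norm_bound_ennreal[OF Bochner_Integration.integrable_diff[OF elim integrable.intros[OF R]]] by simp
      also have "\<dots> = (\<integral>\<^sup>+u. indicator {0<..<t} u * ennreal \<bar>Y u \<omega> - Y (grid t n u) \<omega>\<bar> \<partial>lborel)"
        by (intro nn_integral_cong) (auto simp: indicator_def)
      finally show ?case .
    qed
  qed
  also have "\<dots> = (\<integral>\<^sup>+u. \<integral>\<^sup>+\<omega>. indicator {0<..<t} u * ennreal \<bar>Y u \<omega> - Y (grid t n u) \<omega>\<bar> \<partial>M \<partial>lborel)"
    by (rule nn_integral_swap) measurable
  also have "\<dots> = (\<integral>\<^sup>+u. ennreal (indicator {0<..<t} u * (sqrt (b * (1 - corr (u - grid t n u))) * sqrt (2 / pi))) \<partial>lborel)"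
  proof (rule nn_integral_cong)
    fix u
    have "(\<integral>\<^sup>+\<omega>. ennreal \<bar>Y u \<omega> - Y (grid t n u) \<omega>\<bar> \<partial>M) = ennreal (sqrt (b * (1 - corr (u - grid t n u))) * sqrt (2 / pi))"
      using abs_moment_diff[of u "grid t n u"] by (simp add: nn_integral_eq_integral has_bochner_integral_iff)
    then show "(\<integral>\<^sup>+\<omega>. indicator {0<..<t} u * ennreal \<bar>Y u \<omega> - Y (grid t n u) \<omega>\<bar> \<partial>M)
      = ennreal (indicator {0<..<t} u * (sqrt (b * (1 - corr (u - grid t n u))) * sqrt (2 / pi)))"
      by (subst nn_integral_cmult) (auto simp: indicator_def)
  qed
  also have "\<dots> = ennreal (mesh_error t n)"
    unfolding mesh_error_def using b_pos corr_le_1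
    by (intro nn_integral_eq_integral integrable_mesh AE_I2) auto
  finally show ?thesis .
qed

text \<open>The double sum is kept under the integral over \<pi>, so that the limit in
  \<open>n\<close> can be taken for each \<xi> separately.\<close>

lemma char_riemann:
  "(CLINT \<omega>|M. cis (\<zeta> * riemann t n \<omega>)) = complex_of_real (exp (- (b / 4 * (\<zeta>\<^sup>2 *
     (\<integral>\<xi>. (t / real n)\<^sup>2 * (\<Sum>j<n. \<Sum>k<n. exp (- \<bar>\<xi> * (real j * t / real n - real k * t / real n)\<bar>)) \<partial>\<pi>)))))"
proof -
  have "(CLINT \<omega>|M. cis (\<zeta> * riemann t n \<omega>)) = (CLINT \<omega>|M. cis (\<Sum>j<n. (\<zeta> * (t / real n)) * Y (real j * t / real n) \<omega>))"
    by (simp only: riemann_def sum_distrib_left[symmetric] mult.assoc)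
  also have "(\<integral>\<xi>. (t / real n)\<^sup>2 * (\<Sum>j<n. \<Sum>k<n. exp (- \<bar>\<xi> * (real j * t / real n - real k * t / real n)\<bar>)) \<partial>\<pi>)
     = (t / real n)\<^sup>2 * (\<Sum>j<n. \<Sum>k<n. (\<integral>\<xi>. exp (- \<bar>\<xi> * (real j * t / real n - real k * t / real n)\<bar>) \<partial>\<pi>))"
    by (simp only: integral_mult_right_zero Bochner_Integration.integral_sum Bochner_Integration.integrable_sum integrable_exp_abs)
  ultimately show ?thesis
    unfolding char_sum by (simp only: sum_distrib_left power2_eq_square mult_ac)
qed

lemma variance_riemann_tendsto:
  assumes t: "t > 0"
  shows "(\<lambda>n. \<integral>\<xi>. (t / real n)\<^sup>2 * (\<Sum>j<n. \<Sum>k<n. exp (- \<bar>\<xi> * (real j * t / real n - real k * t / real n)\<bar>)) \<partial>\<pi>)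
    \<longlonglongrightarrow> (\<integral>\<xi>. 2 * t\<^sup>2 * ou_kernel (\<xi> * t) \<partial>\<pi>)"
proof (rule integral_dominated_convergence[where w = "\<lambda>_. t\<^sup>2"])
  show "AE \<xi> in \<pi>. (\<lambda>n. (t / real n)\<^sup>2 * (\<Sum>j<n. \<Sum>k<n. exp (- \<bar>\<xi> * (real j * t / real n - real k * t / real n)\<bar>)))
    \<longlonglongrightarrow> 2 * t\<^sup>2 * ou_kernel (\<xi> * t)"
    using AE_pos by eventually_elim (rule exp_double_riemann_sum_tendsto[OF _ t])
  show "AE \<xi> in \<pi>. norm ((t / real n)\<^sup>2 * (\<Sum>j<n. \<Sum>k<n. exp (- \<bar>\<xi> * (real j * t / real n - real k * t / real n)\<bar>))) \<le> t\<^sup>2" for n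
  proof (rule AE_I2)
    fix \<xi>
    have "(\<Sum>j<n. \<Sum>k<n. exp (- \<bar>\<xi> * (real j * t / real n - real k * t / real n)\<bar>)) \<le> (\<Sum>j<n. \<Sum>k<n. 1)"
      by (intro sum_mono) simp
    also have "\<dots> = (real n)\<^sup>2" by (simp add: power2_eq_square)
    finally have "(t / real n)\<^sup>2 * (\<Sum>j<n. \<Sum>k<n. exp (- \<bar>\<xi> * (real j * t / real n - real k * t / real n)\<bar>)) \<le> (t / real n)\<^sup>2 * (real n)\<^sup>2"
      by (rule mult_left_mono) simp
    \<comment> \<open>Only an inequality, because for \<open>n = 0\<close> the left-hand side is
      0.\<close>
    also have "\<dots> \<le> t\<^sup>2" by (simp add: power_divide)
    finally show "norm ((t / real n)\<^sup>2 * (\<Sum>j<n. \<Sum>k<n. exp (- \<bar>\<xi> * (real j * t / real n - real k * t / real n)\<bar>))) \<le> t\<^sup>2"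
      by (simp add: abs_mult sum_nonneg abs_of_nonneg)
  qed
qed auto

text \<open>The characteristic functions of the Riemann sums have two limits, which must agree: the
  explicit Gaussian one from the variances, and that of \<open>integrated t\<close>, since
  \<open>cis\<close> is 1-Lipschitz and the mean error vanishes.\<close>

lemma char_integrated:
  assumes t: "t > 0"
  shows "(CLINT \<omega>|M. cis (\<zeta> * integrated t \<omega>)) = complex_of_real (exp (- \<zeta>\<^sup>2 * integrated_var t / 2))"
proof (rule LIMSEQ_unique)
  have "(\<lambda>n. CLINT \<omega>|M. cis (\<zeta> * riemann t n \<omega>))
     \<longlonglongrightarrow> complex_of_real (exp (- (b / 4 * (\<zeta>\<^sup>2 * (\<integral>\<xi>. 2 * t\<^sup>2 * ou_kernel (\<xi> * t) \<partial>\<pi>)))))"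
    unfolding char_riemann by (intro tendsto_intros variance_riemann_tendsto t)
  also have "- (b / 4 * (\<zeta>\<^sup>2 * (\<integral>\<xi>. 2 * t\<^sup>2 * ou_kernel (\<xi> * t) \<partial>\<pi>))) = - \<zeta>\<^sup>2 * integrated_var t / 2"
    by (simp add: integrated_var_def)
  finally show "(\<lambda>n. CLINT \<omega>|M. cis (\<zeta> * riemann t n \<omega>)) \<longlonglongrightarrow> complex_of_real (exp (- \<zeta>\<^sup>2 * integrated_var t / 2))" .
  have int: "integrable M (\<lambda>\<omega>. cis (\<zeta> * X \<omega>))" if [measurable]: "X \<in> borel_measurable M" for X
    by (rule integrable_const_bound[where B = 1]) auto
  have le: "norm ((CLINT \<omega>|M. cis (\<zeta> * riemann t n \<omega>)) - (CLINT \<omega>|M. cis (\<zeta> * integrated t \<omega>))) \<le> \<bar>\<zeta>\<bar> * mesh_error t n"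
    if n: "n > 0" for n
  proof -
    have nonneg: "0 \<le> mesh_error t n"
      unfolding mesh_error_def using b_pos corr_le_1 by (intro Bochner_Integration.integral_nonneg) auto
    have I: "integrable M (\<lambda>\<omega>. integrated t \<omega> - riemann t n \<omega>)"
      using integrated_minus_riemann[OF t n] by (intro integrableI_bounded) (auto intro: le_less_trans)
    have "norm ((CLINT \<omega>|M. cis (\<zeta> * riemann t n \<omega>)) - (CLINT \<omega>|M. cis (\<zeta> * integrated t \<omega>)))
      = norm (CLINT \<omega>|M. cis (\<zeta> * riemann t n \<omega>) - cis (\<zeta> * integrated t \<omega>))"
      by (subst Bochner_Integration.integral_diff) (auto intro: int)
    also have "\<dots> \<le> (\<integral>\<omega>. norm (cis (\<zeta> * riemann t n \<omega>) - cis (\<zeta> * integrated t \<omega>)) \<partial>M)"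
      by (rule integral_norm_bound)
    also have "\<dots> \<le> (\<integral>\<omega>. \<bar>\<zeta>\<bar> * \<bar>integrated t \<omega> - riemann t n \<omega>\<bar> \<partial>M)"
    proof (rule integral_mono)
      fix \<omega>
      have "norm (cis (\<zeta> * riemann t n \<omega>) - cis (\<zeta> * integrated t \<omega>)) \<le> \<bar>\<zeta> * riemann t n \<omega> - \<zeta> * integrated t \<omega>\<bar>"
        by (rule norm_cis_diff_le)
      also have "\<dots> = \<bar>\<zeta>\<bar> * \<bar>integrated t \<omega> - riemann t n \<omega>\<bar>"
        by (simp add: abs_mult[symmetric] right_diff_distrib)
      finally show "norm (cis (\<zeta> * riemann t n \<omega>) - cis (\<zeta> * integrated t \<omega>)) \<le> \<bar>\<zeta>\<bar> * \<bar>integrated t \<omega> - riemann t n \<omega>\<bar>" .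
    qed (use I in \<open>auto intro!: integrable_norm Bochner_Integration.integrable_diff int\<close>)
    also have "\<dots> = \<bar>\<zeta>\<bar> * (\<integral>\<omega>. \<bar>integrated t \<omega> - riemann t n \<omega>\<bar> \<partial>M)" by simp
    also have "(\<integral>\<omega>. \<bar>integrated t \<omega> - riemann t n \<omega>\<bar> \<partial>M) \<le> mesh_error t n"
      using integrated_minus_riemann[OF t n] I nonneg by (simp add: nn_integral_eq_integral)
    finally show ?thesis by (simp add: mult_left_mono)
  qed
  have "(\<lambda>n. (CLINT \<omega>|M. cis (\<zeta> * riemann t n \<omega>)) - (CLINT \<omega>|M. cis (\<zeta> * integrated t \<omega>))) \<longlonglongrightarrow> 0"
  proof (rule Lim_null_comparison)
    show "\<forall>\<^sub>F n in sequentially. norm ((CLINT \<omega>|M. cis (\<zeta> * riemann t n \<omega>)) - (CLINT \<omega>|M. cis (\<zeta> * integrated t \<omega>)))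
        \<le> \<bar>\<zeta>\<bar> * mesh_error t n"
      using eventually_gt_at_top[of 0] by eventually_elim (rule le)
    show "(\<lambda>n. \<bar>\<zeta>\<bar> * mesh_error t n) \<longlonglongrightarrow> 0"
      by (rule tendsto_mult_right_zero[OF mesh_error_tendsto_0[OF t]])
  qed
  then show "(\<lambda>n. CLINT \<omega>|M. cis (\<zeta> * riemann t n \<omega>)) \<longlonglongrightarrow> (CLINT \<omega>|M. cis (\<zeta> * integrated t \<omega>))"
    by (rule LIM_zero_cancel)
qed

end

section \<open>From the supOU characterisation to a centred Gaussian process\<close>

text \<open>Taking a single time point in the characterisation shows that \<open>Y t\<close> is
  normal with mean \<open>a\<close> and variance \<open>b / 2\<close>.\<close>

lemma (in prob_space) supOU_process_drift_eq_0:
  assumes Y: "supOU_process M Y a b (null_measure borel) \<pi>" and b: "b > 0"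
    and mean: "(\<integral>\<omega>. Y t \<omega> \<partial>M) = 0"
  shows "a = 0"
proof -
  have \<pi>: "prob_space \<pi>" "sets \<pi> = sets borel" and [measurable]: "\<And>t. Y t \<in> borel_measurable M"
    and ch: "\<And>(n::nat) tt \<zeta>. (CLINT \<omega>|M. cis (\<Sum>j<n. \<zeta> j * Y (tt j) \<omega>)) =
        exp (CLINT z|(\<pi> \<Otimes>\<^sub>M lborel). kappa_L a b (null_measure borel) (\<Sum>j<n. \<zeta> j * supOU_kernel (fst z) (snd z) (tt j)))"
    using Y by (auto simp: supOU_process_def)
  interpret \<pi>: prob_space \<pi> by fact
  have "distributed M lborel (Y t) (normal_density a (sqrt (b / 2)))"
  proof (rule normal_if_char)
    show "(CLINT \<omega>|M. cis (\<zeta> * Y t \<omega>)) = cis (\<zeta> * a) * complex_of_real (exp (- (\<zeta> * sqrt (b / 2))\<^sup>2 / 2))" for \<zeta>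
    proof -
      have "(CLINT \<omega>|M. cis (\<zeta> * Y t \<omega>))
        = exp (\<i> * complex_of_real (\<zeta> * a) + complex_of_real (- (b / 4 * (\<zeta> * \<zeta>))))"
        using ch[of "\<lambda>_. \<zeta>" "\<lambda>_. t" 1] integral_kappa_L_gaussian[OF \<pi>, of a b "\<lambda>_. \<zeta>" "\<lambda>_. t" 1]
        by (simp add: \<pi>.prob_space)
      also have "\<dots> = cis (\<zeta> * a) * complex_of_real (exp (- (\<zeta> * sqrt (b / 2))\<^sup>2 / 2))"
        using b by (simp only: exp_add exp_of_real cis_conv_exp) (simp add: power_mult_distrib power2_eq_square[of \<zeta>])
      finally show ?thesis .
    qed
  qed (use b in auto)
  then have "(\<integral>\<omega>. Y t \<omega> \<partial>M) = a"
    using b by (intro normal_distributed_expectation[of "sqrt (b / 2)"]) auto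
  then show ?thesis using mean by simp
qed

text \<open>\<open>supOU_process\<close> excludes only negative \<xi>; \<open>no_atom\<close>
  supplies the missing point 0, so that \<xi> is almost surely positive.\<close>

lemma gaussian_supOU_if_supOU_process:
  assumes Y: "supOU_process M Y a b (null_measure borel) \<pi>" and b: "b > 0"
    and mean: "\<And>t. (\<integral>\<omega>. Y t \<omega> \<partial>M) = 0"
    and meas: "(\<lambda>(t, \<omega>). Y t \<omega>) \<in> borel_measurable (lborel \<Otimes>\<^sub>M M)"
    and no_atom: "emeasure \<pi> {0} = 0"
  shows "gaussian_supOU M Y b \<pi>"
proof -
  have M: "prob_space M" and \<pi>: "prob_space \<pi>" "sets \<pi> = sets borel" and neg: "emeasure \<pi> {..<0} = 0"
    and ch: "\<And>(n::nat) tt \<zeta>. (CLINT \<omega>|M. cis (\<Sum>j<n. \<zeta> j * Y (tt j) \<omega>)) =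
        exp (CLINT z|(\<pi> \<Otimes>\<^sub>M lborel). kappa_L a b (null_measure borel) (\<Sum>j<n. \<zeta> j * supOU_kernel (fst z) (snd z) (tt j)))"
    using Y by (auto simp: supOU_process_def)
  interpret prob_space M by fact
  have a: "a = 0" by (rule supOU_process_drift_eq_0[OF Y b mean])
  have "{..<0} \<union> {0} \<in> null_sets \<pi>"
    using neg no_atom \<pi>(2) by (intro null_sets.Un) (auto simp: null_sets_def)
  then have AE: "AE \<xi> in \<pi>. 0 < \<xi>"
    by (rule AE_I') (auto simp: not_less)
  have "(CLINT \<omega>|M. cis (\<Sum>j<n. \<zeta> j * Y (tt j) \<omega>)) =
      complex_of_real (exp (- (b / 4 * (\<Sum>j<n. \<Sum>k<n. \<zeta> j * \<zeta> k * (\<integral>\<xi>. exp (- \<bar>\<xi> * (tt j - tt k)\<bar>) \<partial>\<pi>)))))"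
    for n :: nat and \<zeta> tt
    unfolding ch integral_kappa_L_gaussian[OF \<pi>] a exp_of_real[symmetric]
    by (simp only: mult_zero_right of_real_0 diff_0 of_real_minus)
  then show ?thesis
    using M \<pi> b AE meas by (intro gaussian_supOU.intro gaussian_supOU_axioms.intro)
qed

section \<open>Large deviations of the integrated process\<close>

context gaussian_supOU
begin

lemma normal_integrated_div:
  assumes t: "t > 0" and c: "c > 0" and V: "integrated_var t > 0"
  shows "distributed M lborel (\<lambda>\<omega>. integrated t \<omega> / c) (normal_density 0 (sqrt (integrated_var t) / c))"
proof (rule normal_if_char)
  fix \<zeta>
  have "(CLINT \<omega>|M. cis (\<zeta> * (integrated t \<omega> / c))) = complex_of_real (exp (- (\<zeta> / c)\<^sup>2 * integrated_var t / 2))"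
    using char_integrated[OF t, of "\<zeta> / c"] by simp
  then show "(CLINT \<omega>|M. cis (\<zeta> * (integrated t \<omega> / c)))
      = cis (\<zeta> * 0) * complex_of_real (exp (- (\<zeta> * (sqrt (integrated_var t) / c))\<^sup>2 / 2))"
    using V by (simp add: power_mult_distrib power_divide)
qed (use c V in auto)

text \<open>The variance of \<open>R t\<close> is \<open>integrated_var t / (g t)\<^sup>2\<close>
  divided by \<open>s t\<close>, the form required by \<open>LDP_normal\<close>. Since the principle
  concerns only large \<open>t\<close>, the identity for \<open>R\<close> has to hold only
  eventually.\<close>

lemma LDP_integrated:
  assumes var: "((\<lambda>t. integrated_var t / (g t)\<^sup>2) \<longlongrightarrow> \<sigma>) at_top" and \<sigma>: "\<sigma> > 0"
    and g: "\<forall>\<^sub>F t in at_top. g t > 0" and s: "filterlim s at_top at_top"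
    and R: "\<forall>\<^sub>F t in at_top. \<forall>\<omega>. R t \<omega> = integrated t \<omega> / (sqrt (s t) * g t)"
  shows "LDP M R s (\<lambda>x. ereal (1 / (2 * \<sigma>) * x\<^sup>2))"
proof (rule LDP_normal[OF prob_space_axioms _ var \<sigma> s])
  have "\<forall>\<^sub>F t in at_top. s t > 0" using s by (auto simp: filterlim_at_top_dense)
  then show "\<forall>\<^sub>F t in at_top. distributed M lborel (R t) (normal_density 0 (sqrt (integrated_var t / (g t)\<^sup>2 / s t)))"
    using g R eventually_gt_at_top[of 0] order_tendstoD(1)[OF var \<sigma>]
  proof eventually_elim
    case (elim t)
    then have V: "integrated_var t > 0" by (simp add: zero_less_divide_iff)
    have "R t = (\<lambda>\<omega>. integrated t \<omega> / (sqrt (s t) * g t))" using elim by auto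
    moreover have "sqrt (integrated_var t) / (sqrt (s t) * g t) = sqrt (integrated_var t / (g t)\<^sup>2 / s t)"
      using elim by (simp add: real_sqrt_divide real_sqrt_mult)
    ultimately show ?case
      using normal_integrated_div[of t "sqrt (s t) * g t"] elim V by simp
  qed
qed

end

theorem theorem5p5:
  fixes M :: "'w measure" and Y :: "real \<Rightarrow> 'w \<Rightarrow> real"
    and a b \<alpha> :: real and p L s :: "real \<Rightarrow> real"
  assumes supOU: "supOU_process M Y a b (null_measure borel) (density lborel (\<lambda>x. ennreal (p x)))"
    and b_pos: "b > 0"
    and p_meas: "p \<in> borel_measurable borel" and p_nonneg: "\<And>x. p x \<ge> 0"
    and mean0: "\<And>t. integrable M (Y t) \<and> (\<integral>\<omega>. Y t \<omega> \<partial>M) = 0"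
    and meas: "(\<lambda>(t, \<omega>). Y t \<omega>) \<in> borel_measurable (lborel \<Otimes>\<^sub>M M)"
    and \<alpha>: "0 < \<alpha>" "\<alpha> < 1"
    and L: "slowly_varying L"
    and p_asymp: "p \<sim>[at_right 0] (\<lambda>x. \<alpha> * L (1 / x) * x powr (\<alpha> - 1))"
    and s_pos: "\<And>t. t > 0 \<Longrightarrow> s t > 0"
    and s_lim: "filterlim s at_top at_top"
  shows "LDP M
           (\<lambda>t \<omega>. (1 / sqrt (s t)) *
                ((LBINT u=0..t. Y u \<omega>) / (t powr (1 - \<alpha> / 2) * sqrt (L t))))
           s
           (\<lambda>x. ereal (1 / (2 * b) * ((2 - \<alpha>) * (1 - \<alpha>) / Gamma (1 + \<alpha>)) * x^2))"
proof -
  let ?\<pi> = "density lborel (\<lambda>x. ennreal (p x))"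
  note [measurable] = p_meas
  have "emeasure ?\<pi> {0} = 0"
    by (subst emeasure_density) (auto simp: nn_integral_0_iff_AE AE_lborel_singleton intro!: AE_mp[OF AE_lborel_singleton[of 0]])
  then interpret gaussian_supOU M Y b ?\<pi>
    using mean0 by (intro gaussian_supOU_if_supOU_process[OF supOU b_pos _ meas]) auto
  have p_int: "integrable lborel p"
    using \<pi>.emeasure_space_1 p_nonneg by (intro integrableI_nonneg) (auto simp: emeasure_density)
  \<comment> \<open>Positivity \<pi>-almost everywhere means that \<open>p\<close> vanishes
    Lebesgue-almost everywhere on the nonpositive axis. This restricts the variance integral to the
    half-line of the Abelian theorem.\<close>
  have AE_p: "AE x in lborel. p x = indicator {0<..} x * p x"
    using AE_pos by (subst (asm) AE_density) (auto elim!: eventually_mono simp: indicator_def order.antisym[OF _ p_nonneg] not_less)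
  have var_eq: "integrated_var t = b * t\<^sup>2 * (\<integral>x. indicator {0<..} x * (p x * ou_kernel (x * t)) \<partial>lborel)" for t
  proof -
    have "(\<integral>\<xi>. ou_kernel (\<xi> * t) \<partial>?\<pi>) = (\<integral>x. p x * ou_kernel (x * t) \<partial>lborel)"
      using p_nonneg by (subst integral_density) auto
    also have "\<dots> = (\<integral>x. indicator {0<..} x * (p x * ou_kernel (x * t)) \<partial>lborel)"
      using AE_p by (intro integral_cong_AE) (auto elim!: eventually_mono)
    finally show ?thesis by (simp add: integrated_var_def)
  qed
  define \<sigma> where "\<sigma> = b * (Gamma (1 + \<alpha>) / ((1 - \<alpha>) * (2 - \<alpha>)))"
  have "Gamma (1 + \<alpha>) > 0" using \<alpha> by (intro Gamma_real_pos) auto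
  then have \<sigma>: "\<sigma> > 0" using b_pos \<alpha> by (simp add: \<sigma>_def)
  define g where "g t = t powr (1 - \<alpha> / 2) * sqrt (L t)" for t
  have L_pos: "\<forall>\<^sub>F t in at_top. L t > 0" using L by (simp add: slowly_varying_def)
  then have g_pos: "\<forall>\<^sub>F t in at_top. g t > 0"
    using eventually_gt_at_top[of 0] by eventually_elim (simp add: g_def)
  have "((\<lambda>t. t powr \<alpha> / L t * (\<integral>x. indicator {0<..} x * (p x * ou_kernel (x * t)) \<partial>lborel))
      \<longlongrightarrow> Gamma (1 + \<alpha>) / ((1 - \<alpha>) * (2 - \<alpha>))) at_top"
    using abelian_regularly_varying[OF L \<alpha> \<alpha>(1) ou_kernel_measurable ou_kernel_nonneg ou_kernel_le_1
        ou_kernel_le_inverse p_int p_nonneg p_asymp]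
    by (simp only: integral_powr_ou_kernel[OF \<alpha>])
  from tendsto_mult[OF tendsto_const[of b] this]
  have "((\<lambda>t. b * (t powr \<alpha> / L t * (\<integral>x. indicator {0<..} x * (p x * ou_kernel (x * t)) \<partial>lborel))) \<longlongrightarrow> \<sigma>) at_top"
    by (simp only: \<sigma>_def)
  moreover have "\<forall>\<^sub>F t in at_top. b * (t powr \<alpha> / L t * (\<integral>x. indicator {0<..} x * (p x * ou_kernel (x * t)) \<partial>lborel))
      = integrated_var t / (g t)\<^sup>2"
    using L_pos eventually_gt_at_top[of 0]
  proof eventually_elim
    case (elim t)
    \<comment> \<open>The normalisation is chosen for this: dividing the prefactor
      \<open>t\<^sup>2\<close> of the variance by \<open>(g t)\<^sup>2\<close> leaves the factor
      \<open>t powr \<alpha> / L t\<close> of the Abelian theorem.\<close>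
    have "(t powr (1 - \<alpha> / 2))\<^sup>2 = t powr (2 - \<alpha>)"
      using elim by (simp add: power2_eq_square flip: powr_add)
    also have "\<dots> = t\<^sup>2 / t powr \<alpha>" using elim by (simp add: powr_diff)
    finally show ?case
      using elim by (simp add: var_eq g_def power_mult_distrib)
  qed
  ultimately have var: "((\<lambda>t. integrated_var t / (g t)\<^sup>2) \<longlongrightarrow> \<sigma>) at_top"
    by (rule Lim_transform_eventually)
  have "LDP M (\<lambda>t \<omega>. (1 / sqrt (s t)) * ((LBINT u=0..t. Y u \<omega>) / (t powr (1 - \<alpha> / 2) * sqrt (L t)))) s
      (\<lambda>x. ereal (1 / (2 * \<sigma>) * x\<^sup>2))"
  proof (rule LDP_integrated[OF var \<sigma> g_pos s_lim])
    show "\<forall>\<^sub>F t in at_top. \<forall>\<omega>. (1 / sqrt (s t)) * ((LBINT u=0..t. Y u \<omega>) / (t powr (1 - \<alpha> / 2) * sqrt (L t)))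
        = integrated t \<omega> / (sqrt (s t) * g t)"
      using eventually_gt_at_top[of 0]
      by eventually_elim
         (auto simp: integrated_def g_def interval_lebesgue_integral_def set_lebesgue_integral_def zero_ereal_def)
  qed
  also have "1 / (2 * \<sigma>) = 1 / (2 * b) * ((2 - \<alpha>) * (1 - \<alpha>) / Gamma (1 + \<alpha>))"
    by (simp add: \<sigma>_def mult.commute)
  finally show ?thesis .
qed

end
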